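(* Let $(A,\Delta)$ be an algebraic quantum group with dual $B=\widehat A$, let $\psi$ be a fixed right integral on $A$, and let $\mathcal F:A\to B$ be the Fourier transform $\mathcal F(x)=\psi(S(\,\cdot\,)x)$. For all $a,x\in A$ and $b\in B$ we have $$\mathcal F(ax)=\mathcal F(x)\triangleleft S^{-1}(a)\qquad\text{and}\qquad\mathcal F(b\triangleright x)=b\,\mathcal F(x).$$
   Context: All algebras are associative algebras over $\mathbb C$, possibly non-unital, with non-degenerate product; $M(A)$ is the multiplier algebra of $A$; $\iota$ denotes identity maps. Regular multiplier Hopf algebra: an algebra $A$ with a homomorphism $\Delta:A\to M(A\otimes A)$ such that $\Delta(a)(1\otimes a')$, $(a\otimes 1)\Delta(a')$, $\Delta(a)(a'\otimes 1)$ and $(1\otimes a)\Delta(a')$ lie in $A\otimes A$ for all $a,a'$; $\Delta$ is coassociative, $(a\otimes1\otimes1)(\Delta\otimes\iota)(\Delta(c)(1\otimes a'))=((\iota\otimes\Delta)((a\otimes1)\Delta(c)))(1\otimes1\otimes a')$; and the maps $a\otimes a'\mapsto\Delta(a)(1\otimes a')$, $a\otimes a'\mapsto(a\otimes1)\Delta(a')$, and the same two maps for the flipped coproduct, are bijections of $A\otimes A$. It has a unique counit $\varepsilon:A\to\mathbb C$ (a homomorphism) and antipode $S:A\to A$ (a bijective anti-homomorphism), characterized by $(\varepsilon\otimes\iota)(\Delta(a)(1\otimes a'))=aa'$ and $m(S\otimes\iota)(\Delta(a)(1\otimes a'))=\varepsilon(a)a'$, with $m$ the multiplication. A left (right) integral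 is a non-zero linear functional $\varphi$ (resp. $\psi$) on $A$ with $(\iota\otimes\varphi)\Delta(a)=\varphi(a)1$ (resp. $(\psi\otimes\iota)\Delta(a)=\psi(a)1$) in $M(A)$ for all $a$. An algebraic quantum group is a regular multiplier Hopf algebra with integrals. Dual: $B=\widehat A=\{\varphi(\,\cdot\,c):c\in A\}$, with $\langle a,b\rangle=b(a)$ and product $\langle a,bb'\rangle=\langle\Delta(a),b\otimes b'\rangle$. All functionals $\psi(S(\,\cdot\,)x)$ belong to $B$. Actions: $b\triangleleft a\in B$ is given by $\langle a',b\triangleleft a\rangle=\langle aa',b\rangle$ for $a,a'\in A$, $b\in B$; $b\triangleright x\in A$ is given by $\langle b\triangleright x,b'\rangle=\langle x,b'b\rangle$, i.e. $b\triangleright x=(\iota\otimes\langle\,\cdot\,,b\rangle)\Delta(x)$. *)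

theory Defs
  imports Complex_Main "HOL-Library.Poly_Mapping"
begin

section \<open>Complex vector spaces and algebras\<close>

class scaleC =
  fixes scaleC :: "complex \<Rightarrow> 'a \<Rightarrow> 'a" (infixr \<open>*\<^sub>C\<close> 75)

class complex_vector = scaleC + ab_group_add +
  assumes scaleC_add_right: "a *\<^sub>C (x + y) = a *\<^sub>C x + a *\<^sub>C y"
    and scaleC_add_left: "(a + b) *\<^sub>C x = a *\<^sub>C x + b *\<^sub>C x"
    and scaleC_scaleC: "a *\<^sub>C (b *\<^sub>C x) = (a * b) *\<^sub>C x"
    and scaleC_one: "1 *\<^sub>C x = x"

class complex_algebra = complex_vector + ring +
  assumes mult_scaleC_left: "(a *\<^sub>C x) * y = a *\<^sub>C (x * y)"
    and mult_scaleC_right: "x * (a *\<^sub>C y) = a *\<^sub>C (x * y)"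

instantiation complex :: complex_algebra
begin

definition scaleC_complex :: "complex \<Rightarrow> complex \<Rightarrow> complex" where
  "scaleC_complex c x = c * x"

instance
  by standard (simp_all add: scaleC_complex_def algebra_simps)

end

global_interpretation complex_vector: vector_space "scaleC :: complex \<Rightarrow> 'a \<Rightarrow> 'a::complex_vector"
  by standard (simp_all add: scaleC_add_right scaleC_add_left scaleC_scaleC scaleC_one)

abbreviation clinear :: "('a::complex_vector \<Rightarrow> 'b::complex_vector) \<Rightarrow> bool" where
  "clinear \<equiv> Vector_Spaces.linear scaleC scaleC"

global_interpretation complex_vector_pair:
  vector_space_pair "scaleC :: complex \<Rightarrow> 'a \<Rightarrow> 'a::complex_vector"
    "scaleC :: complex \<Rightarrow> 'b \<Rightarrow> 'b::complex_vector"
  by standard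

lemma clinear_iff:
  "clinear f \<longleftrightarrow> (\<forall>x y. f (x + y) = f x + f y) \<and> (\<forall>c x. f (c *\<^sub>C x) = c *\<^sub>C f x)"
  by (auto simp: Vector_Spaces.linear_iff complex_vector.vector_space_axioms)

lemma clinearI:
  assumes "\<And>x y. f (x + y) = f x + f y" "\<And>c x. f (c *\<^sub>C x) = c *\<^sub>C f x"
  shows "clinear f"
  using assms by (simp add: clinear_iff)

lemma clinear_add: "clinear f \<Longrightarrow> f (x + y) = f x + f y"
  and clinear_scaleC: "clinear f \<Longrightarrow> f (c *\<^sub>C x) = c *\<^sub>C f x"
  by (simp_all add: clinear_iff)

lemma clinear_0: "clinear f \<Longrightarrow> f 0 = 0"
  by (metis add_cancel_right_right add.right_neutral clinear_iff)

lemma clinear_diff: "clinear f \<Longrightarrow> f (x - y) = f x - f y"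
  by (metis clinear_add diff_add_cancel eq_diff_eq)

lemma clinear_compose: "clinear f \<Longrightarrow> clinear g \<Longrightarrow> clinear (\<lambda>x. f (g x))"
  by (simp add: clinear_iff)

definition cbilinear :: "('a::complex_vector \<Rightarrow> 'b::complex_vector \<Rightarrow> 'c::complex_vector) \<Rightarrow> bool" where
  "cbilinear f \<longleftrightarrow> (\<forall>b. clinear (\<lambda>a. f a b)) \<and> (\<forall>a. clinear (f a))"

lemma cbilinearI:
  assumes "\<And>x y b. f (x + y) b = f x b + f y b" "\<And>c x b. f (c *\<^sub>C x) b = c *\<^sub>C f x b"
    "\<And>a x y. f a (x + y) = f a x + f a y" "\<And>a c x. f a (c *\<^sub>C x) = c *\<^sub>C f a x"
  shows "cbilinear f"
  using assms by (simp add: cbilinear_def clinear_iff)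

lemma cbilinearD:
  assumes "cbilinear f"
  shows "f (x + y) b = f x b + f y b" "f (c *\<^sub>C x) b = c *\<^sub>C f x b"
    "f a (u + v) = f a u + f a v" "f a (c *\<^sub>C u) = c *\<^sub>C f a u"
  using assms by (simp_all add: cbilinear_def clinear_iff)


section \<open>The algebraic tensor product\<close>

instantiation poly_mapping :: (type, complex_vector) complex_vector
begin

lift_definition scaleC_poly_mapping :: "complex \<Rightarrow> ('a \<Rightarrow>\<^sub>0 'b) \<Rightarrow> 'a \<Rightarrow>\<^sub>0 'b"
  is "\<lambda>c f k. c *\<^sub>C f k"
  by (erule finite_subset[rotated]) auto

instance
  by standard
    (transfer; simp add: fun_eq_iff scaleC_add_right scaleC_add_left scaleC_scaleC scaleC_one)+

end

lemma lookup_scaleC: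
  "Poly_Mapping.lookup (c *\<^sub>C f) k = c *\<^sub>C Poly_Mapping.lookup f k"
  by transfer simp

text \<open>The free vector space on \<open>'a \<times> 'b\<close> consists of the finitely supported functions.
  The tensor product is its quotient by the subspace spanned by the bilinearity relations.\<close>

definition tensor_relations ::
  "(('a::complex_vector \<times> 'b::complex_vector) \<Rightarrow>\<^sub>0 complex) set" where
  "tensor_relations =
     {Poly_Mapping.single (a + a', b) 1 - Poly_Mapping.single (a, b) 1
        - Poly_Mapping.single (a', b) 1 | a a' b. True} \<union>
     {Poly_Mapping.single (a, b + b') 1 - Poly_Mapping.single (a, b) 1
        - Poly_Mapping.single (a, b') 1 | a b b'. True} \<union>
     {Poly_Mapping.single (c *\<^sub>C a, b) 1 - c *\<^sub>C Poly_Mapping.single (a, b) 1 | c a b. True} \<union>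
     {Poly_Mapping.single (a, c *\<^sub>C b) 1 - c *\<^sub>C Poly_Mapping.single (a, b) 1 | c a b. True}"

definition tensor_rel ::
  "(('a::complex_vector \<times> 'b::complex_vector) \<Rightarrow>\<^sub>0 complex) \<Rightarrow>
   (('a \<times> 'b) \<Rightarrow>\<^sub>0 complex) \<Rightarrow> bool" where
  "tensor_rel x y \<longleftrightarrow> x - y \<in> complex_vector.span tensor_relations"

lemma equivp_tensor_rel:
  "equivp (tensor_rel :: (('a::complex_vector \<times> 'b::complex_vector) \<Rightarrow>\<^sub>0 complex) \<Rightarrow> _)"
proof (rule equivpI)
  show "reflp (tensor_rel :: (('a \<times> 'b) \<Rightarrow>\<^sub>0 complex) \<Rightarrow> _)"
    by (simp add: reflp_def tensor_rel_def complex_vector.span_zero)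
  show "symp (tensor_rel :: (('a \<times> 'b) \<Rightarrow>\<^sub>0 complex) \<Rightarrow> _)"
    unfolding symp_def tensor_rel_def
    by (metis complex_vector.span_neg minus_diff_eq)
  show "transp (tensor_rel :: (('a \<times> 'b) \<Rightarrow>\<^sub>0 complex) \<Rightarrow> _)"
  proof (rule transpI)
    fix x y z :: "('a \<times> 'b) \<Rightarrow>\<^sub>0 complex"
    assume "tensor_rel x y" "tensor_rel y z"
    then have "(x - y) + (y - z) \<in> complex_vector.span tensor_relations"
      unfolding tensor_rel_def by (rule complex_vector.span_add)
    then show "tensor_rel x z" by (simp add: tensor_rel_def)
  qed
qed

quotient_type (overloaded) ('a, 'b) tensor =
  "(('a::complex_vector \<times> 'b::complex_vector) \<Rightarrow>\<^sub>0 complex)" / tensor_rel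
  by (rule equivp_tensor_rel)

instantiation tensor :: (complex_vector, complex_vector) complex_vector
begin

lift_definition zero_tensor :: "('a, 'b) tensor" is 0 .

lift_definition plus_tensor :: "('a, 'b) tensor \<Rightarrow> ('a, 'b) tensor \<Rightarrow> ('a, 'b) tensor" is "(+)"
  unfolding tensor_rel_def
  by (drule (1) complex_vector.span_add) (simp add: algebra_simps)

lift_definition uminus_tensor :: "('a, 'b) tensor \<Rightarrow> ('a, 'b) tensor" is uminus
  unfolding tensor_rel_def
  by (drule complex_vector.span_neg) (simp add: algebra_simps)

lift_definition minus_tensor :: "('a, 'b) tensor \<Rightarrow> ('a, 'b) tensor \<Rightarrow> ('a, 'b) tensor" is "(-)"
  unfolding tensor_rel_def
  by (drule (1) complex_vector.span_diff) (simp add: algebra_simps)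

lift_definition scaleC_tensor :: "complex \<Rightarrow> ('a, 'b) tensor \<Rightarrow> ('a, 'b) tensor" is scaleC
  unfolding tensor_rel_def
  by (metis complex_vector.span_scale complex_vector.scale_right_diff_distrib)

instance
proof
  fix x y z :: "('a, 'b) tensor" and a b :: complex
  have refl: "tensor_rel p p" for p :: "('a \<times> 'b) \<Rightarrow>\<^sub>0 complex"
    using equivp_reflp[OF equivp_tensor_rel] .
  show "x + y + z = x + (y + z)" by transfer (simp add: add.assoc refl)
  show "x + y = y + x" by transfer (simp add: add.commute refl)
  show "0 + x = x" by transfer (simp add: refl)
  show "- x + x = 0" by transfer (simp add: refl)
  show "x - y = x + - y" by transfer (simp add: refl)
  show "a *\<^sub>C (x + y) = a *\<^sub>C x + a *\<^sub>C y" by transfer (simp add: scaleC_add_right refl)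
  show "(a + b) *\<^sub>C x = a *\<^sub>C x + b *\<^sub>C x" by transfer (simp add: scaleC_add_left refl)
  show "a *\<^sub>C b *\<^sub>C x = (a * b) *\<^sub>C x" by transfer (simp add: scaleC_scaleC refl)
  show "1 *\<^sub>C x = x" by transfer (simp add: scaleC_one refl)
qed

end

lift_definition tensor :: "'a::complex_vector \<Rightarrow> 'b::complex_vector \<Rightarrow> ('a, 'b) tensor"
  (infixr \<open>\<otimes>\<close> 72)
  is "\<lambda>a b. Poly_Mapping.single (a, b) 1" .

lemma cbilinear_tensor: "cbilinear (\<otimes>)"
proof (rule cbilinearI)
  fix x y a :: 'a and u v b :: 'b and c :: complex
  show "(x + y) \<otimes> b = x \<otimes> b + y \<otimes> b"
    apply transfer
    unfolding tensor_rel_def diff_diff_eq[symmetric]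
    by (rule complex_vector.span_base) (unfold tensor_relations_def, blast)
  show "(c *\<^sub>C x) \<otimes> b = c *\<^sub>C (x \<otimes> b)"
    apply transfer
    unfolding tensor_rel_def
    by (rule complex_vector.span_base) (unfold tensor_relations_def, blast)
  show "a \<otimes> (u + v) = a \<otimes> u + a \<otimes> v"
    apply transfer
    unfolding tensor_rel_def diff_diff_eq[symmetric]
    by (rule complex_vector.span_base) (unfold tensor_relations_def, blast)
  show "a \<otimes> (c *\<^sub>C u) = c *\<^sub>C (a \<otimes> u)"
    apply transfer
    unfolding tensor_rel_def
    by (rule complex_vector.span_base) (unfold tensor_relations_def, blast)
qed

lemmas tensor_simps = cbilinearD[OF cbilinear_tensor]

lemma tensor_zero_left: "0 \<otimes> b = 0"
  using tensor_simps(2)[of 0 0 b] by simp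

lemma tensor_induct [case_names tensor add]:
  assumes tensor: "\<And>a b. P (a \<otimes> b)" and add: "\<And>s t. P s \<Longrightarrow> P t \<Longrightarrow> P (s + t)"
  shows "P t"
proof -
  have P0: "P 0" using tensor[of 0] by (simp add: tensor_zero_left)
  have "P (abs_tensor p)" for p :: "('a \<times> 'b) \<Rightarrow>\<^sub>0 complex"
  proof (induction "card (Poly_Mapping.keys p)" arbitrary: p)
    case 0
    then have "p = 0" by simp
    then show ?case using P0 by (simp add: zero_tensor_def)
  next
    case (Suc n)
    then have "Poly_Mapping.keys p \<noteq> {}" by (metis card.empty nat.distinct(1))
    then obtain k where k: "k \<in> Poly_Mapping.keys p" by blast
    define q where "q = p - Poly_Mapping.single k (Poly_Mapping.lookup p k)"
    have "Poly_Mapping.keys q = Poly_Mapping.keys p - {k}"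
      by (auto simp: q_def in_keys_iff lookup_minus lookup_single when_def split: if_splits)
    then have "P (abs_tensor q)" using Suc k by simp
    moreover have "P (abs_tensor (Poly_Mapping.single k (Poly_Mapping.lookup p k)))"
    proof -
      obtain a b where ab: "k = (a, b)" by (cases k)
      have "Poly_Mapping.single k (Poly_Mapping.lookup p k)
          = Poly_Mapping.lookup p k *\<^sub>C Poly_Mapping.single (a, b) 1"
        by (rule poly_mapping_eqI)
          (auto simp: ab lookup_scaleC scaleC_complex_def lookup_single when_def)
      then have "abs_tensor (Poly_Mapping.single k (Poly_Mapping.lookup p k))
          = Poly_Mapping.lookup p k *\<^sub>C (a \<otimes> b)"
        by (simp add: tensor.abs_eq scaleC_tensor.abs_eq)
      also have "\<dots> = (Poly_Mapping.lookup p k *\<^sub>C a) \<otimes> b"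
        by (simp only: tensor_simps)
      finally show ?thesis using tensor by simp
    qed
    moreover have "abs_tensor p
        = abs_tensor q + abs_tensor (Poly_Mapping.single k (Poly_Mapping.lookup p k))"
      by (simp add: plus_tensor.abs_eq q_def)
    ultimately show ?case using add by simp
  qed
  then show ?thesis by (cases t) (auto intro: tensor.abs_induct)
qed

text \<open>The linear map induced by a bilinear map (universal property). The value is only
  meaningful when \<open>f\<close> is bilinear.\<close>

definition free_extension ::
  "('a \<Rightarrow> 'b \<Rightarrow> 'c::complex_vector) \<Rightarrow> (('a \<times> 'b) \<Rightarrow>\<^sub>0 complex) \<Rightarrow> 'c" where
  "free_extension f p =
     (\<Sum>k\<in>Poly_Mapping.keys p. Poly_Mapping.lookup p k *\<^sub>C f (fst k) (snd k))"

definition tensor_lift ::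
  "('a::complex_vector \<Rightarrow> 'b::complex_vector \<Rightarrow> 'c::complex_vector) \<Rightarrow> ('a, 'b) tensor \<Rightarrow> 'c" where
  "tensor_lift f t = free_extension f (rep_tensor t)"

lemma free_extension_superset:
  assumes "finite K" "Poly_Mapping.keys p \<subseteq> K"
  shows "free_extension f p = (\<Sum>k\<in>K. Poly_Mapping.lookup p k *\<^sub>C f (fst k) (snd k))"
  unfolding free_extension_def
  by (rule sum.mono_neutral_left) (use assms in \<open>auto simp: in_keys_iff\<close>)

lemma clinear_free_extension: "clinear (free_extension f)"
proof (rule clinearI)
  fix p q :: "('a \<times> 'b) \<Rightarrow>\<^sub>0 complex" and c
  let ?K = "Poly_Mapping.keys p \<union> Poly_Mapping.keys q"
  have "Poly_Mapping.keys (p + q) \<subseteq> ?K" by (rule Poly_Mapping.keys_add)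
  then show "free_extension f (p + q) = free_extension f p + free_extension f q"
    by (simp add: free_extension_superset[of ?K] lookup_add scaleC_add_left sum.distrib)
  have "Poly_Mapping.keys (c *\<^sub>C p) \<subseteq> Poly_Mapping.keys p"
    by (auto simp: in_keys_iff lookup_scaleC scaleC_complex_def)
  then show "free_extension f (c *\<^sub>C p) = c *\<^sub>C free_extension f p"
    by (simp add: free_extension_superset[of "Poly_Mapping.keys p"] lookup_scaleC
        complex_vector.scale_sum_right scaleC_scaleC scaleC_complex_def)
qed

lemma free_extension_single: "free_extension f (Poly_Mapping.single (a, b) 1) = f a b"
  by (simp add: free_extension_def scaleC_one)

lemma free_extension_span:
  assumes f: "cbilinear f" and p: "p \<in> complex_vector.span tensor_relations"
  shows "free_extension f p = 0"
  using p
proof (induction rule: complex_vector.span_induct_alt)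
  case base
  then show ?case by (rule clinear_0[OF clinear_free_extension])
next
  case (step c x y)
  have "free_extension f x = 0"
    using step(1) unfolding tensor_relations_def
    by (auto simp: clinear_diff[OF clinear_free_extension]
        clinear_scaleC[OF clinear_free_extension] free_extension_single cbilinearD[OF f])
  then show ?case
    using step by (simp add: clinear_add[OF clinear_free_extension]
        clinear_scaleC[OF clinear_free_extension])
qed

lemma tensor_lift_abs:
  assumes "cbilinear f"
  shows "tensor_lift f (abs_tensor p) = free_extension f p"
proof -
  have "tensor_rel (rep_tensor (abs_tensor p)) p"
    using Quotient3_rep_abs[OF Quotient3_tensor] equivp_reflp[OF equivp_tensor_rel]
    by blast
  then show ?thesis
    using free_extension_span[OF assms]
    by (fastforce simp: tensor_rel_def tensor_lift_def clinear_diff[OF clinear_free_extension])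
qed

lemma tensor_lift_tensor: "cbilinear f \<Longrightarrow> tensor_lift f (a \<otimes> b) = f a b"
  by (simp add: tensor.abs_eq tensor_lift_abs free_extension_single)

lemma clinear_tensor_lift:
  assumes "cbilinear f"
  shows "clinear (tensor_lift f)"
proof (rule clinearI)
  fix s t :: "('a, 'b) tensor" and c
  obtain p q where st: "s = abs_tensor p" "t = abs_tensor q"
    by (metis Quotient3_tensor Quotient3_def)
  show "tensor_lift f (s + t) = tensor_lift f s + tensor_lift f t"
    by (simp add: st plus_tensor.abs_eq tensor_lift_abs[OF assms]
        clinear_add[OF clinear_free_extension])
  show "tensor_lift f (c *\<^sub>C s) = c *\<^sub>C tensor_lift f s"
    by (simp add: st scaleC_tensor.abs_eq tensor_lift_abs[OF assms]
        clinear_scaleC[OF clinear_free_extension])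
qed

lemma tensor_ext:
  assumes "clinear f" "clinear g" "\<And>a b. f (a \<otimes> b) = g (a \<otimes> b)"
  shows "f t = g t"
  by (induction t rule: tensor_induct) (simp_all add: assms clinear_add)

lemma tensor_universal_property:
  assumes "cbilinear f"
  shows "\<exists>!g. clinear g \<and> (\<forall>a b. g (a \<otimes> b) = f a b)"
  using clinear_tensor_lift[OF assms] tensor_lift_tensor[OF assms]
  by (metis (no_types, lifting) ext tensor_ext)

definition tensor_map ::
  "('a::complex_vector \<Rightarrow> 'c::complex_vector) \<Rightarrow> ('b::complex_vector \<Rightarrow> 'd::complex_vector)
   \<Rightarrow> ('a, 'b) tensor \<Rightarrow> ('c, 'd) tensor" where
  "tensor_map f g = tensor_lift (\<lambda>a b. f a \<otimes> g b)"

lemma cbilinear_tensor_map: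
  "clinear f \<Longrightarrow> clinear g \<Longrightarrow> cbilinear (\<lambda>a b. f a \<otimes> g b)"
  by (rule cbilinearI) (simp_all add: clinear_add clinear_scaleC tensor_simps)

lemma tensor_map_tensor:
  "clinear f \<Longrightarrow> clinear g \<Longrightarrow> tensor_map f g (a \<otimes> b) = f a \<otimes> g b"
  by (simp add: tensor_map_def tensor_lift_tensor cbilinear_tensor_map)

lemma clinear_tensor_map:
  "clinear f \<Longrightarrow> clinear g \<Longrightarrow> clinear (tensor_map f g)"
  by (simp add: tensor_map_def clinear_tensor_lift cbilinear_tensor_map)

subsection \<open>The product on a tensor product of algebras\<close>

instantiation tensor :: (complex_algebra, complex_algebra) complex_algebra
begin

definition times_tensor :: "('a, 'b) tensor \<Rightarrow> ('a, 'b) tensor \<Rightarrow> ('a, 'b) tensor" where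
  "s * t = tensor_lift (\<lambda>a b. tensor_map ((*) a) ((*) b) t) s"

lemma clinear_mult_left: "clinear ((*) (a::'c::complex_algebra))"
  by (rule clinearI) (simp_all add: distrib_left mult_scaleC_right)

lemma clinear_mult_right: "clinear (\<lambda>x. x * (a::'c::complex_algebra))"
  by (rule clinearI) (simp_all add: distrib_right mult_scaleC_left)

lemma cbilinear_times_aux:
  "cbilinear (\<lambda>a b. tensor_map ((*) a) ((*) b) (t :: ('a, 'b) tensor))"
proof (rule cbilinearI)
  fix x y a :: 'a and u v b :: 'b and c :: complex
  note lin = clinear_add[OF clinear_tensor_map] clinear_mult_left
  show "tensor_map ((*) (x + y)) ((*) b) t
      = tensor_map ((*) x) ((*) b) t + tensor_map ((*) y) ((*) b) t"
    by (induction t rule: tensor_induct, simp add: tensor_map_tensor clinear_mult_left,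
        simp add: distrib_right tensor_simps, simp add: lin ac_simps)
  show "tensor_map ((*) (c *\<^sub>C x)) ((*) b) t = c *\<^sub>C tensor_map ((*) x) ((*) b) t"
    by (induction t rule: tensor_induct, simp add: tensor_map_tensor clinear_mult_left,
        simp add: mult_scaleC_left tensor_simps, simp add: lin scaleC_add_right)
  show "tensor_map ((*) a) ((*) (u + v)) t
      = tensor_map ((*) a) ((*) u) t + tensor_map ((*) a) ((*) v) t"
    by (induction t rule: tensor_induct, simp add: tensor_map_tensor clinear_mult_left,
        simp add: distrib_right tensor_simps, simp add: lin ac_simps)
  show "tensor_map ((*) a) ((*) (c *\<^sub>C u)) t = c *\<^sub>C tensor_map ((*) a) ((*) u) t"
    by (induction t rule: tensor_induct, simp add: tensor_map_tensor clinear_mult_left,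
        simp add: mult_scaleC_left tensor_simps, simp add: lin scaleC_add_right)
qed

lemma tensor_mult: "(a \<otimes> b) * (c \<otimes> d) = (a * c) \<otimes> (b * d)"
  for a c :: 'a and b d :: 'b
  unfolding times_tensor_def tensor_lift_tensor[OF cbilinear_times_aux]
  by (simp add: tensor_map_tensor clinear_mult_left)

lemma tensor_mult_linear:
  fixes r s t :: "('a, 'b) tensor"
  shows "(r + s) * t = r * t + s * t" "r * (s + t) = r * s + r * t"
    "(c *\<^sub>C r) * s = c *\<^sub>C (r * s)" "r * (c *\<^sub>C s) = c *\<^sub>C (r * s)"
proof -
  note l = clinear_tensor_lift[OF cbilinear_times_aux]
  show A: "(r + s) * t = r * t + s * t" for r s t :: "('a, 'b) tensor"
    by (simp add: times_tensor_def clinear_add[OF l])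
  show "(c *\<^sub>C r) * s = c *\<^sub>C (r * s)"
    by (simp add: times_tensor_def clinear_scaleC[OF l])
  have B: "(a \<otimes> b) * t = tensor_map ((*) a) ((*) b) t" for a :: 'a and b :: 'b and t
    by (simp add: times_tensor_def tensor_lift_tensor[OF cbilinear_times_aux])
  note m = clinear_tensor_map[OF clinear_mult_left clinear_mult_left]
  show "r * (s + t) = r * s + r * t"
    by (induction r rule: tensor_induct) (simp_all add: A B clinear_add[OF m])
  show "r * (c *\<^sub>C s) = c *\<^sub>C (r * s)"
    by (induction r rule: tensor_induct)
      (simp_all add: A B clinear_scaleC[OF m] scaleC_add_right)
qed

instance
proof
  fix r s t :: "('a, 'b) tensor" and c :: complex
  have 1: "(a \<otimes> b) * (p \<otimes> q) * t = (a \<otimes> b) * ((p \<otimes> q) * t)" for a p :: 'a and b q :: 'b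
    by (induction t rule: tensor_induct)
      (simp_all add: tensor_mult tensor_mult_linear mult.assoc)
  have 2: "(a \<otimes> b) * s * t = (a \<otimes> b) * (s * t)" for a :: 'a and b :: 'b
    by (induction s rule: tensor_induct) (simp_all add: 1 tensor_mult_linear)
  show "r * s * t = r * (s * t)"
    by (induction r rule: tensor_induct) (simp_all add: 2 tensor_mult_linear)
qed (simp_all add: tensor_mult_linear)

end

definition tensor_flip ::
  "('a::complex_vector, 'b::complex_vector) tensor \<Rightarrow> ('b, 'a) tensor" where
  "tensor_flip = tensor_lift (\<lambda>a b. b \<otimes> a)"

definition tensor_assoc ::
  "(('a::complex_vector, 'b::complex_vector) tensor, 'c::complex_vector) tensor
   \<Rightarrow> ('a, ('b, 'c) tensor) tensor" where
  "tensor_assoc = tensor_lift (\<lambda>s c. tensor_lift (\<lambda>a b. a \<otimes> (b \<otimes> c)) s)"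

definition algebra_iso :: "('a::complex_algebra \<Rightarrow> 'b::complex_algebra) \<Rightarrow> bool" where
  "algebra_iso f \<longleftrightarrow> clinear f \<and> bij f \<and> (\<forall>x y. f (x * y) = f x * f y)"

lemma cbilinear_flip: "cbilinear (\<lambda>a b. b \<otimes> a)"
  by (rule cbilinearI) (simp_all add: tensor_simps)

lemma tensor_flip_tensor: "tensor_flip (a \<otimes> b) = b \<otimes> a"
  by (simp add: tensor_flip_def tensor_lift_tensor cbilinear_flip)

lemma clinear_tensor_flip: "clinear tensor_flip"
  by (simp add: tensor_flip_def clinear_tensor_lift cbilinear_flip)

lemma tensor_flip_flip: "tensor_flip (tensor_flip t) = t"
  by (induction t rule: tensor_induct)
    (simp_all add: tensor_flip_tensor clinear_add[OF clinear_tensor_flip])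

lemma algebra_hom_tensorI:
  fixes f :: "('a::complex_algebra, 'b::complex_algebra) tensor \<Rightarrow> 'c::complex_algebra"
  assumes f: "clinear f"
    and e: "\<And>a b c d. f ((a \<otimes> b) * (c \<otimes> d)) = f (a \<otimes> b) * f (c \<otimes> d)"
  shows "f (s * t) = f s * f t"
proof -
  have "f ((a \<otimes> b) * t) = f (a \<otimes> b) * f t" for a b
    by (induction t rule: tensor_induct) (simp_all add: e distrib_left clinear_add[OF f])
  then show ?thesis
    by (induction s rule: tensor_induct) (simp_all add: distrib_right clinear_add[OF f])
qed

lemma algebra_iso_tensor_flip: "algebra_iso tensor_flip"
proof -
  have "bij (tensor_flip :: ('a, 'b) tensor \<Rightarrow> _)"
    by (rule bij_betw_byWitness[of _ tensor_flip]) (simp_all add: tensor_flip_flip)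
  moreover have "tensor_flip (s * t) = tensor_flip s * tensor_flip t" for s t :: "('a, 'b) tensor"
    by (rule algebra_hom_tensorI[OF clinear_tensor_flip]) (simp add: tensor_flip_tensor tensor_mult)
  ultimately show ?thesis
    by (simp add: algebra_iso_def clinear_tensor_flip)
qed

lemma cbilinear_assoc_aux: "cbilinear (\<lambda>a b. a \<otimes> (b \<otimes> c))"
  by (rule cbilinearI) (simp_all add: tensor_simps)

lemma cbilinear_assoc:
  "cbilinear (\<lambda>s c. tensor_lift (\<lambda>a b. a \<otimes> (b \<otimes> c)) s)"
proof (rule cbilinearI)
  note l = clinear_tensor_lift[OF cbilinear_assoc_aux]
    and lt = tensor_lift_tensor[OF cbilinear_assoc_aux]
  fix s t :: "('a, 'b) tensor" and x y :: 'c and c :: complex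
  show "tensor_lift (\<lambda>a b. a \<otimes> (b \<otimes> x)) (s + t)
      = tensor_lift (\<lambda>a b. a \<otimes> (b \<otimes> x)) s + tensor_lift (\<lambda>a b. a \<otimes> (b \<otimes> x)) t"
    by (rule clinear_add[OF l])
  show "tensor_lift (\<lambda>a b. a \<otimes> (b \<otimes> x)) (c *\<^sub>C s)
      = c *\<^sub>C tensor_lift (\<lambda>a b. a \<otimes> (b \<otimes> x)) s"
    by (rule clinear_scaleC[OF l])
  show "tensor_lift (\<lambda>a b. a \<otimes> (b \<otimes> (x + y))) s
      = tensor_lift (\<lambda>a b. a \<otimes> (b \<otimes> x)) s + tensor_lift (\<lambda>a b. a \<otimes> (b \<otimes> y)) s"
    by (induction s rule: tensor_induct, simp only: lt, simp only: tensor_simps,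
        simp only: clinear_add[OF l] ac_simps)
  show "tensor_lift (\<lambda>a b. a \<otimes> (b \<otimes> (c *\<^sub>C x))) s
      = c *\<^sub>C tensor_lift (\<lambda>a b. a \<otimes> (b \<otimes> x)) s"
    by (induction s rule: tensor_induct, simp only: lt, simp only: tensor_simps,
        simp only: clinear_add[OF l] scaleC_add_right)
qed

lemma tensor_assoc_tensor: "tensor_assoc ((a \<otimes> b) \<otimes> c) = a \<otimes> (b \<otimes> c)"
  by (simp add: tensor_assoc_def tensor_lift_tensor cbilinear_assoc cbilinear_assoc_aux)

lemma clinear_tensor_assoc: "clinear tensor_assoc"
  by (simp add: tensor_assoc_def clinear_tensor_lift cbilinear_assoc)

lemma tensor3_induct:
  assumes "\<And>a b c. P ((a \<otimes> b) \<otimes> c)" "\<And>s t. P s \<Longrightarrow> P t \<Longrightarrow> P (s + t)"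
  shows "P t"
proof (induction t rule: tensor_induct)
  case (tensor s c)
  show ?case
    by (induction s rule: tensor_induct) (simp_all add: assms tensor_simps)
qed (simp add: assms)

lemma tensor3_induct':
  assumes "\<And>a b c. P (a \<otimes> (b \<otimes> c))" "\<And>s t. P s \<Longrightarrow> P t \<Longrightarrow> P (s + t)"
  shows "P t"
proof (induction t rule: tensor_induct)
  case (tensor a s)
  show ?case
    by (induction s rule: tensor_induct) (simp_all add: assms tensor_simps)
qed (simp add: assms)

lemma algebra_iso_tensor_assoc: "algebra_iso tensor_assoc"
proof -
  define g :: "('a, ('b, 'c) tensor) tensor \<Rightarrow> (('a, 'b) tensor, 'c) tensor"
    where "g t = tensor_flip (tensor_map id tensor_flip
             (tensor_assoc (tensor_map tensor_flip id (tensor_flip t))))" for t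
  have id: "clinear id" by (simp add: clinear_iff)
  note l = clinear_add[OF clinear_tensor_flip] clinear_add[OF clinear_tensor_assoc]
    clinear_add[OF clinear_tensor_map[OF clinear_tensor_flip id]]
    clinear_add[OF clinear_tensor_map[OF id clinear_tensor_flip]]
  have g_tensor: "g (a \<otimes> (b \<otimes> c)) = (a \<otimes> b) \<otimes> c" for a b c
    by (simp add: g_def tensor_flip_tensor tensor_assoc_tensor
        tensor_map_tensor[OF clinear_tensor_flip id] tensor_map_tensor[OF id clinear_tensor_flip])
  have g_add: "g (s + t) = g s + g t" for s t
    by (simp add: g_def l)
  have "g (tensor_assoc t) = t" for t
    by (induction t rule: tensor3_induct)
      (simp_all add: tensor_assoc_tensor g_tensor l g_add)
  moreover have "tensor_assoc (g t) = t" for t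
    by (induction t rule: tensor3_induct')
      (simp_all add: tensor_assoc_tensor g_tensor l g_add)
  ultimately have "bij (tensor_assoc :: (('a, 'b) tensor, 'c) tensor \<Rightarrow> _)"
    by (intro o_bij[of g]) (simp_all add: fun_eq_iff)
  moreover have "tensor_assoc (((a \<otimes> b) \<otimes> c) * t) = tensor_assoc ((a \<otimes> b) \<otimes> c) * tensor_assoc t"
    for a :: 'a and b :: 'b and c :: 'c and t
    by (induction t rule: tensor3_induct)
      (simp_all add: tensor_mult tensor_assoc_tensor l distrib_left)
  then have "tensor_assoc (s * t) = tensor_assoc s * tensor_assoc t"
    for s t :: "(('a, 'b) tensor, 'c) tensor"
    by (induction s rule: tensor3_induct) (simp_all add: l distrib_right)
  ultimately show ?thesis
    by (simp add: algebra_iso_def clinear_tensor_assoc)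
qed


section \<open>The multiplier algebra\<close>

text \<open>A multiplier \<open>m\<close> is a pair of maps \<open>a \<mapsto> m a\<close> and \<open>a \<mapsto> a m\<close>. When the product is
  non-degenerate, the last condition implies the other four.\<close>

definition is_multiplier :: "('a::complex_algebra \<Rightarrow> 'a) \<Rightarrow> ('a \<Rightarrow> 'a) \<Rightarrow> bool" where
  "is_multiplier L R \<longleftrightarrow> clinear L \<and> clinear R \<and>
      (\<forall>a b. L (a * b) = L a * b) \<and> (\<forall>a b. R (a * b) = a * R b) \<and>
      (\<forall>a b. a * L b = R a * b)"

lemma is_multiplier_id: "is_multiplier id id"
  by (simp add: is_multiplier_def clinear_iff)

typedef (overloaded) 'a multiplier =
  "{(L :: 'a::complex_algebra \<Rightarrow> 'a, R :: 'a \<Rightarrow> 'a). is_multiplier L R}"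
  using is_multiplier_id by blast

setup_lifting type_definition_multiplier

lift_definition lmul :: "'a::complex_algebra multiplier \<Rightarrow> 'a \<Rightarrow> 'a" is fst .

lift_definition rmul :: "'a::complex_algebra multiplier \<Rightarrow> 'a \<Rightarrow> 'a" is snd .

lemma multiplier_eqI:
  "(\<And>a. lmul m a = lmul n a) \<Longrightarrow> (\<And>a. rmul m a = rmul n a) \<Longrightarrow> m = n"
  by transfer (auto simp: fun_eq_iff prod_eq_iff)

lemma clinear_lmul: "clinear (lmul m)" and clinear_rmul: "clinear (rmul m)"
  by (transfer; auto simp: is_multiplier_def)+

lemma lmul_mult: "lmul m (a * b) = lmul m a * b"
  and rmul_mult: "rmul m (a * b) = a * rmul m b"
  and mult_lmul: "a * lmul m b = rmul m a * b"
  by (transfer; auto simp: is_multiplier_def)+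

instantiation multiplier :: (complex_algebra) complex_algebra
begin

lift_definition zero_multiplier :: "'a multiplier" is "(\<lambda>a. 0, \<lambda>a. 0)"
  by (simp add: is_multiplier_def clinear_iff)

lift_definition plus_multiplier :: "'a multiplier \<Rightarrow> 'a multiplier \<Rightarrow> 'a multiplier"
  is "\<lambda>(L, R) (L', R'). (\<lambda>a. L a + L' a, \<lambda>a. R a + R' a)"
  by (auto simp: is_multiplier_def clinear_iff distrib_left distrib_right scaleC_add_right)

lift_definition uminus_multiplier :: "'a multiplier \<Rightarrow> 'a multiplier"
  is "\<lambda>(L, R). (\<lambda>a. - L a, \<lambda>a. - R a)"
  by (auto simp: is_multiplier_def clinear_iff)

lift_definition minus_multiplier :: "'a multiplier \<Rightarrow> 'a multiplier \<Rightarrow> 'a multiplier"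
  is "\<lambda>(L, R) (L', R'). (\<lambda>a. L a - L' a, \<lambda>a. R a - R' a)"
  by (auto simp: is_multiplier_def clinear_iff right_diff_distrib left_diff_distrib
      complex_vector.scale_right_diff_distrib)

lift_definition scaleC_multiplier :: "complex \<Rightarrow> 'a multiplier \<Rightarrow> 'a multiplier"
  is "\<lambda>c (L, R). (\<lambda>a. c *\<^sub>C L a, \<lambda>a. c *\<^sub>C R a)"
  by (auto simp: is_multiplier_def clinear_iff scaleC_add_right mult_scaleC_left
      mult_scaleC_right scaleC_scaleC mult.commute)

lift_definition times_multiplier :: "'a multiplier \<Rightarrow> 'a multiplier \<Rightarrow> 'a multiplier"
  is "\<lambda>(L, R) (L', R'). (\<lambda>a. L (L' a), \<lambda>a. R' (R a))"
  by (auto simp: is_multiplier_def clinear_iff)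

lemma lmul_rmul_arith:
  "lmul 0 a = 0" "rmul 0 a = 0"
  "lmul (m + n) a = lmul m a + lmul n a" "rmul (m + n) a = rmul m a + rmul n a"
  "lmul (- m) a = - lmul m a" "rmul (- m) a = - rmul m a"
  "lmul (m - n) a = lmul m a - lmul n a" "rmul (m - n) a = rmul m a - rmul n a"
  "lmul (c *\<^sub>C m) a = c *\<^sub>C lmul m a" "rmul (c *\<^sub>C m) a = c *\<^sub>C rmul m a"
  "lmul (m * n) a = lmul m (lmul n a)" "rmul (m * n) a = rmul n (rmul m a)"
  for m n :: "'a multiplier"
  by (transfer; auto)+

instance
  by standard
    (rule multiplier_eqI;
      simp add: lmul_rmul_arith clinear_add[OF clinear_lmul] clinear_add[OF clinear_rmul]
        clinear_scaleC[OF clinear_lmul] clinear_scaleC[OF clinear_rmul]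
        scaleC_add_right scaleC_add_left scaleC_scaleC scaleC_one algebra_simps)+

end

instantiation multiplier :: (complex_algebra) monoid_mult
begin

lift_definition one_multiplier :: "'a multiplier" is "(\<lambda>a. a, \<lambda>a. a)"
  by (simp add: is_multiplier_def clinear_iff)

instance
  by standard (transfer; auto)+

end

lemma lmul_rmul_one [simp]: "lmul 1 a = a" "rmul 1 a = a"
  by (transfer; simp)+

declare lmul_rmul_arith [simp]

lift_definition embed :: "'a::complex_algebra \<Rightarrow> 'a multiplier"
  is "\<lambda>x. (\<lambda>a. x * a, \<lambda>a. a * x)"
  by (auto simp: is_multiplier_def clinear_iff distrib_left distrib_right mult_scaleC_left mult_scaleC_right
      mult.assoc)

lemma lmul_embed [simp]: "lmul (embed x) a = x * a"
  and rmul_embed [simp]: "rmul (embed x) a = a * x"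
  by (transfer; force)+

text \<open>The element of the algebra that a multiplier in the image of \<^const>\<open>embed\<close> comes from.\<close>

definition unembed :: "'a::complex_algebra multiplier \<Rightarrow> 'a" where
  "unembed m = (THE x. embed x = m)"

lemma is_multiplier_tensor_map:
  assumes "is_multiplier L R" "is_multiplier L' R'"
  shows "is_multiplier (tensor_map L L') (tensor_map R R')"
proof -
  let ?L = "tensor_map L L'" and ?R = "tensor_map R R'"
  have l: "clinear L" "clinear R" "clinear L'" "clinear R'"
    and m: "L (a * b) = L a * b" "R (a * b) = a * R b" "a * L b = R a * b"
    and m': "L' (c * d) = L' c * d" "R' (c * d) = c * R' d" "c * L' d = R' c * d" for a b c d
    using assms by (auto simp: is_multiplier_def)
  have lin: "clinear ?L" "clinear ?R"
    by (simp_all add: clinear_tensor_map l)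
  note add = clinear_add[OF lin(1)] clinear_add[OF lin(2)]
    and t = tensor_map_tensor[OF l(1,3)] tensor_map_tensor[OF l(2,4)] tensor_mult
  have L1: "?L ((a \<otimes> b) * u) = ?L (a \<otimes> b) * u" for a b u
    by (induction u rule: tensor_induct) (simp_all add: add distrib_left t m(1) m'(1))
  have L: "?L (s * u) = ?L s * u" for s u
    by (induction s rule: tensor_induct) (simp_all only: add distrib_right L1)
  have R1: "?R ((a \<otimes> b) * u) = (a \<otimes> b) * ?R u" for a b u
    by (induction u rule: tensor_induct) (simp_all add: add distrib_left t m(2) m'(2))
  have R: "?R (s * u) = s * ?R u" for s u
    by (induction s rule: tensor_induct) (simp_all only: add distrib_right R1)
  have LR1: "(a \<otimes> b) * ?L u = ?R (a \<otimes> b) * u" for a b u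
    by (induction u rule: tensor_induct) (simp_all add: add distrib_left t m(3) m'(3))
  have LR: "s * ?L u = ?R s * u" for s u
    by (induction s rule: tensor_induct) (simp_all only: add distrib_right LR1)
  show ?thesis
    using lin L R LR by (simp add: is_multiplier_def)
qed

text \<open>\<open>m \<otimes> n\<close> for multipliers \<open>m\<close> and \<open>n\<close>, as a multiplier of the tensor product.\<close>

lift_definition mtensor ::
  "'a::complex_algebra multiplier \<Rightarrow> 'b::complex_algebra multiplier \<Rightarrow> ('a, 'b) tensor multiplier"
  is "\<lambda>(L, R) (L', R'). (tensor_map L L', tensor_map R R')"
  by (auto intro: is_multiplier_tensor_map)

lemma lmul_mtensor: "lmul (mtensor m n) = tensor_map (lmul m) (lmul n)"
  and rmul_mtensor: "rmul (mtensor m n) = tensor_map (rmul m) (rmul n)"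
  by (transfer; force)+

lemma is_multiplier_iso:
  fixes f :: "'a::complex_algebra \<Rightarrow> 'b::complex_algebra"
  assumes "is_multiplier L R" "algebra_iso f"
  shows "is_multiplier (\<lambda>b. f (L (inv f b))) (\<lambda>b. f (R (inv f b)))"
proof -
  have l: "clinear L" "clinear R"
    and m: "L (a * b) = L a * b" "R (a * b) = a * R b" "a * L b = R a * b" for a b
    using assms by (auto simp: is_multiplier_def)
  have f: "clinear f" "f (x * y) = f x * f y" "inv f (f x) = x" "f (inv f z) = z" for x y z
    using assms by (auto simp: algebra_iso_def bij_is_inj bij_is_surj surj_f_inv_f)
  have g: "inv f (x + y) = inv f x + inv f y" "inv f (c *\<^sub>C x) = c *\<^sub>C inv f x"
    "inv f (x * y) = inv f x * inv f y" for x y c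
    using f(3)[of "inv f x + inv f y"] f(3)[of "c *\<^sub>C inv f x"] f(3)[of "inv f x * inv f y"]
    by (simp_all add: f(2,4) clinear_add[OF f(1)] clinear_scaleC[OF f(1)])
  then have ginv: "clinear (inv f)" by (simp add: clinear_iff)
  have "clinear (\<lambda>b. f (L (inv f b)))" "clinear (\<lambda>b. f (R (inv f b)))"
    by (intro clinear_compose[OF f(1)] clinear_compose[OF l(1)] clinear_compose[OF l(2)] ginv)+
  moreover have "f (L (inv f (x * y))) = f (L (inv f x)) * y" for x y
    by (simp add: g m(1) f(2,4))
  moreover have "f (R (inv f (x * y))) = x * f (R (inv f y))" for x y
    by (simp add: g m(2) f(2,4))
  moreover have "x * f (L (inv f y)) = f (R (inv f x)) * y" for x y
  proof -
    have "x * f (L (inv f y)) = f (inv f x * L (inv f y))" by (simp only: f(2,4))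
    also have "\<dots> = f (R (inv f x)) * y" by (simp only: m(3) f(2,4))
    finally show ?thesis .
  qed
  ultimately show ?thesis by (simp add: is_multiplier_def)
qed

text \<open>The extension of an algebra isomorphism to the multiplier algebras.\<close>

lift_definition multiplier_map ::
  "('a::complex_algebra \<Rightarrow> 'b::complex_algebra) \<Rightarrow> 'a multiplier \<Rightarrow> 'b multiplier"
  is "\<lambda>f (L, R). if algebra_iso f then (\<lambda>b. f (L (inv f b)), \<lambda>b. f (R (inv f b)))
                 else (id, id)"
  by (auto intro: is_multiplier_iso is_multiplier_id split: if_splits)

lemma lmul_multiplier_map: "algebra_iso f \<Longrightarrow> lmul (multiplier_map f m) b = f (lmul m (inv f b))"
  and rmul_multiplier_map: "algebra_iso f \<Longrightarrow> rmul (multiplier_map f m) b = f (rmul m (inv f b))"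
  by (transfer; force)+


section \<open>Slice maps\<close>

definition slice_left :: "('a \<Rightarrow> complex) \<Rightarrow> ('a::complex_vector, 'b::complex_vector) tensor \<Rightarrow> 'b" where
  "slice_left \<omega> = tensor_lift (\<lambda>a b. \<omega> a *\<^sub>C b)"

definition slice_right :: "('b \<Rightarrow> complex) \<Rightarrow> ('a::complex_vector, 'b::complex_vector) tensor \<Rightarrow> 'a" where
  "slice_right \<omega> = tensor_lift (\<lambda>a b. \<omega> b *\<^sub>C a)"

text \<open>\<open>(\<omega> \<otimes> \<iota>) m\<close> and \<open>(\<iota> \<otimes> \<omega>) m\<close> as elements of \<open>M(A)\<close>, for a multiplier \<open>m\<close> of
  \<open>A \<otimes> A\<close> whose products with \<open>1 \<otimes> a\<close>, respectively \<open>a \<otimes> 1\<close>, from both sides lie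
  in \<open>A \<otimes> A\<close>. For example \<open>((\<iota> \<otimes> \<omega>) m) a = (\<iota> \<otimes> \<omega>) (m (a \<otimes> 1))\<close>.\<close>

definition mslice_left ::
  "('a::complex_algebra \<Rightarrow> complex) \<Rightarrow> ('a, 'a) tensor multiplier \<Rightarrow> 'a multiplier" where
  "mslice_left \<omega> m = (THE n. \<forall>a.
     lmul n a = slice_left \<omega> (unembed (m * mtensor 1 (embed a))) \<and>
     rmul n a = slice_left \<omega> (unembed (mtensor 1 (embed a) * m)))"

definition mslice_right ::
  "('a::complex_algebra \<Rightarrow> complex) \<Rightarrow> ('a, 'a) tensor multiplier \<Rightarrow> 'a multiplier" where
  "mslice_right \<omega> m = (THE n. \<forall>a.
     lmul n a = slice_right \<omega> (unembed (m * mtensor (embed a) 1)) \<and>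
     rmul n a = slice_right \<omega> (unembed (mtensor (embed a) 1 * m)))"


section \<open>Algebraic quantum groups\<close>

text \<open>The maps \<open>a \<otimes> a' \<mapsto> \<Delta>(a)(1 \<otimes> a')\<close> and \<open>a \<otimes> a' \<mapsto> (a \<otimes> 1)\<Delta>(a')\<close>.\<close>

definition canonical_map1 ::
  "('a::complex_algebra \<Rightarrow> ('a, 'a) tensor multiplier) \<Rightarrow> ('a, 'a) tensor \<Rightarrow> ('a, 'a) tensor" where
  "canonical_map1 \<Delta> = tensor_lift (\<lambda>a a'. unembed (\<Delta> a * mtensor 1 (embed a')))"

definition canonical_map2 ::
  "('a::complex_algebra \<Rightarrow> ('a, 'a) tensor multiplier) \<Rightarrow> ('a, 'a) tensor \<Rightarrow> ('a, 'a) tensor" where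
  "canonical_map2 \<Delta> = tensor_lift (\<lambda>a a'. unembed (mtensor (embed a) 1 * \<Delta> a'))"

definition flipped_coproduct ::
  "('a::complex_algebra \<Rightarrow> ('a, 'a) tensor multiplier) \<Rightarrow> 'a \<Rightarrow> ('a, 'a) tensor multiplier" where
  "flipped_coproduct \<Delta> a = multiplier_map tensor_flip (\<Delta> a)"

text \<open>In \<open>coassociative\<close>, the tensor lifts are the maps \<open>\<Delta> \<otimes> \<iota>\<close> and \<open>\<iota> \<otimes> \<Delta>\<close> from \<open>A \<otimes> A\<close> to
  \<open>M((A \<otimes> A) \<otimes> A)\<close> and \<open>M(A \<otimes> (A \<otimes> A))\<close>; these two algebras are identified via the associator.\<close>

locale regular_multiplier_hopf_algebra =
  fixes \<Delta> :: "'a::complex_algebra \<Rightarrow> ('a, 'a) tensor multiplier"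
  assumes nondegenerate_left: "\<And>a::'a. (\<forall>b. a * b = 0) \<Longrightarrow> a = 0"
    and nondegenerate_right: "\<And>b::'a. (\<forall>a. a * b = 0) \<Longrightarrow> b = 0"
    and clinear_coproduct: "clinear \<Delta>"
    and coproduct_mult: "\<And>a b. \<Delta> (a * b) = \<Delta> a * \<Delta> b"
    and range1: "\<And>a a'. \<Delta> a * mtensor 1 (embed a') \<in> range embed"
    and range2: "\<And>a a'. mtensor (embed a) 1 * \<Delta> a' \<in> range embed"
    and range3: "\<And>a a'. \<Delta> a * mtensor (embed a') 1 \<in> range embed"
    and range4: "\<And>a a'. mtensor 1 (embed a) * \<Delta> a' \<in> range embed"
    and coassociative: "\<And>a a' c.
      multiplier_map tensor_assoc
        (mtensor (mtensor (embed a) 1) 1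
          * tensor_lift (\<lambda>p q. mtensor (\<Delta> p) (embed q)) (unembed (\<Delta> c * mtensor 1 (embed a'))))
      = tensor_lift (\<lambda>p q. mtensor (embed p) (\<Delta> q)) (unembed (mtensor (embed a) 1 * \<Delta> c))
          * mtensor 1 (mtensor 1 (embed a'))"
    and bij1: "bij (canonical_map1 \<Delta>)"
    and bij2: "bij (canonical_map2 \<Delta>)"
    and bij_flipped1: "bij (canonical_map1 (flipped_coproduct \<Delta>))"
    and bij_flipped2: "bij (canonical_map2 (flipped_coproduct \<Delta>))"

definition is_counit ::
  "('a::complex_algebra \<Rightarrow> ('a, 'a) tensor multiplier) \<Rightarrow> ('a \<Rightarrow> complex) \<Rightarrow> bool" where
  "is_counit \<Delta> \<epsilon> \<longleftrightarrow> clinear \<epsilon> \<and> (\<forall>a b. \<epsilon> (a * b) = \<epsilon> a * \<epsilon> b) \<and>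
     (\<forall>a a'. slice_left \<epsilon> (unembed (\<Delta> a * mtensor 1 (embed a'))) = a * a')"

definition is_antipode ::
  "('a::complex_algebra \<Rightarrow> ('a, 'a) tensor multiplier) \<Rightarrow> ('a \<Rightarrow> complex) \<Rightarrow> ('a \<Rightarrow> 'a) \<Rightarrow> bool" where
  "is_antipode \<Delta> \<epsilon> S \<longleftrightarrow> clinear S \<and> bij S \<and> (\<forall>a b. S (a * b) = S b * S a) \<and>
     (\<forall>a a'. tensor_lift (\<lambda>p q. S p * q) (unembed (\<Delta> a * mtensor 1 (embed a'))) = \<epsilon> a *\<^sub>C a')"

definition left_integral ::
  "('a::complex_algebra \<Rightarrow> ('a, 'a) tensor multiplier) \<Rightarrow> ('a \<Rightarrow> complex) \<Rightarrow> bool" where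
  "left_integral \<Delta> \<phi> \<longleftrightarrow> clinear \<phi> \<and> \<phi> \<noteq> (\<lambda>a. 0) \<and>
     (\<forall>a. mslice_right \<phi> (\<Delta> a) = \<phi> a *\<^sub>C 1)"

definition right_integral ::
  "('a::complex_algebra \<Rightarrow> ('a, 'a) tensor multiplier) \<Rightarrow> ('a \<Rightarrow> complex) \<Rightarrow> bool" where
  "right_integral \<Delta> \<psi> \<longleftrightarrow> clinear \<psi> \<and> \<psi> \<noteq> (\<lambda>a. 0) \<and>
     (\<forall>a. mslice_left \<psi> (\<Delta> a) = \<psi> a *\<^sub>C 1)"

locale algebraic_quantum_group = regular_multiplier_hopf_algebra \<Delta>
  for \<Delta> :: "'a::complex_algebra \<Rightarrow> ('a, 'a) tensor multiplier" +
  assumes ex_left_integral: "\<exists>\<phi>. left_integral \<Delta> \<phi>"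
    and ex_right_integral: "\<exists>\<psi>. right_integral \<Delta> \<psi>"


section \<open>The dual, its actions and the Fourier transform\<close>

definition dual :: "('a::complex_algebra \<Rightarrow> complex) \<Rightarrow> ('a \<Rightarrow> complex) set" where
  "dual \<phi> = {\<lambda>a. \<phi> (a * c) | c. True}"

text \<open>\<open>\<langle>m, b \<otimes> b'\<rangle>\<close> for a multiplier \<open>m\<close> of \<open>A \<otimes> A\<close> such that \<open>(\<iota> \<otimes> b') m\<close> lies in \<open>A\<close>.\<close>

definition tensor_pairing ::
  "('a::complex_algebra, 'a) tensor multiplier \<Rightarrow> ('a \<Rightarrow> complex) \<Rightarrow> ('a \<Rightarrow> complex) \<Rightarrow> complex" where
  "tensor_pairing m b b' = b (unembed (mslice_right b' m))"

definition dual_mult ::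
  "('a::complex_algebra \<Rightarrow> ('a, 'a) tensor multiplier) \<Rightarrow> ('a \<Rightarrow> complex) \<Rightarrow> ('a \<Rightarrow> complex)
   \<Rightarrow> ('a \<Rightarrow> complex)" where
  "dual_mult \<Delta> b b' = (\<lambda>a. tensor_pairing (\<Delta> a) b b')"

text \<open>The actions \<open>b \<triangleleft> a \<in> B\<close> and \<open>b \<triangleright> x \<in> A\<close>.\<close>

definition act_on_dual :: "('a::complex_algebra \<Rightarrow> complex) \<Rightarrow> 'a \<Rightarrow> ('a \<Rightarrow> complex)" where
  "act_on_dual b a = (\<lambda>a'. b (a * a'))"

definition dual_act ::
  "('a::complex_algebra \<Rightarrow> ('a, 'a) tensor multiplier) \<Rightarrow> ('a \<Rightarrow> complex) \<Rightarrow> 'a \<Rightarrow> 'a" where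
  "dual_act \<Delta> b x = unembed (mslice_right b (\<Delta> x))"

definition fourier ::
  "('a::complex_algebra \<Rightarrow> complex) \<Rightarrow> ('a \<Rightarrow> 'a) \<Rightarrow> 'a \<Rightarrow> ('a \<Rightarrow> complex)" where
  "fourier \<psi> S x = (\<lambda>a. \<psi> (S a * x))"

section \<open>Consequences of the definitions\<close>

lemma cbilinear_slice_left: "clinear \<omega> \<Longrightarrow> cbilinear (\<lambda>a b. \<omega> a *\<^sub>C b)"
  by (rule cbilinearI)
    (simp_all add: clinear_add clinear_scaleC scaleC_add_left scaleC_add_right scaleC_scaleC
      scaleC_complex_def mult.commute)

lemma cbilinear_slice_right: "clinear \<omega> \<Longrightarrow> cbilinear (\<lambda>a b. \<omega> b *\<^sub>C a)"
  by (rule cbilinearI)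
    (simp_all add: clinear_add clinear_scaleC scaleC_add_left scaleC_add_right scaleC_scaleC
      scaleC_complex_def mult.commute)

lemma slice_left_tensor: "clinear \<omega> \<Longrightarrow> slice_left \<omega> (a \<otimes> b) = \<omega> a *\<^sub>C b"
  by (simp add: slice_left_def tensor_lift_tensor cbilinear_slice_left)

lemma slice_right_tensor: "clinear \<omega> \<Longrightarrow> slice_right \<omega> (a \<otimes> b) = \<omega> b *\<^sub>C a"
  by (simp add: slice_right_def tensor_lift_tensor cbilinear_slice_right)

lemma clinear_slice_left: "clinear \<omega> \<Longrightarrow> clinear (slice_left \<omega>)"
  and clinear_slice_right: "clinear \<omega> \<Longrightarrow> clinear (slice_right \<omega>)"
  by (simp_all add: slice_left_def slice_right_def clinear_tensor_lift cbilinear_slice_left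
      cbilinear_slice_right)

lemma clinear_sum: "clinear f \<Longrightarrow> f (sum g F) = (\<Sum>x\<in>F. f (g x))"
  by (induction F rule: infinite_finite_induct) (simp_all add: clinear_0 clinear_add)

lemma clinear_tensor_left: "clinear (\<lambda>a. a \<otimes> b)"
  by (rule clinearI) (simp_all add: tensor_simps)

lemma tensor_eq_0I:
  fixes t :: "('a::complex_vector, 'b::complex_vector) tensor"
  assumes "\<And>\<omega>. clinear \<omega> \<Longrightarrow> slice_left \<omega> t = 0"
  shows "t = 0"
proof -
  obtain B :: "'a set" where B: "complex_vector.independent B" "complex_vector.span B = UNIV"
    by (metis complex_vector.maximal_independent_subset top.extremum_unique)
  have "\<exists>F p. finite F \<and> F \<subseteq> B \<and> t = (\<Sum>e\<in>F. e \<otimes> p e)" for t :: "('a, 'b) tensor"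
  proof (induction t rule: tensor_induct)
    case (tensor a b)
    have "a \<in> complex_vector.span B" using B by simp
    then obtain F r where F: "finite F" "F \<subseteq> B" "a = (\<Sum>e\<in>F. r e *\<^sub>C e)"
      unfolding complex_vector.span_explicit by blast
    then have "a \<otimes> b = (\<Sum>e\<in>F. (r e *\<^sub>C e) \<otimes> b)"
      by (simp add: clinear_sum[OF clinear_tensor_left])
    also have "\<dots> = (\<Sum>e\<in>F. e \<otimes> (r e *\<^sub>C b))" by (simp add: tensor_simps)
    finally show ?case using F by (intro exI[of _ F] exI[of _ "\<lambda>e. r e *\<^sub>C b"]) simp
  next
    case (add s t)
    then obtain F p G q where F: "finite F" "F \<subseteq> B" "s = (\<Sum>e\<in>F. e \<otimes> p e)"
      and G: "finite G" "G \<subseteq> B" "t = (\<Sum>e\<in>G. e \<otimes> q e)" by blast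
    let ?p = "\<lambda>e. if e \<in> F then p e else 0" and ?q = "\<lambda>e. if e \<in> G then q e else 0"
    have z: "e \<otimes> (0::'b) = 0" for e :: 'a using tensor_simps(4)[of e 0 0] by simp
    have "s = (\<Sum>e\<in>F \<union> G. e \<otimes> ?p e)" "t = (\<Sum>e\<in>F \<union> G. e \<otimes> ?q e)"
      unfolding F(3) G(3) using F(1) G(1) by (auto intro!: sum.mono_neutral_cong_left simp: z)
    then have "s + t = (\<Sum>e\<in>F \<union> G. e \<otimes> (?p e + ?q e))"
      by (simp add: sum.distrib tensor_simps)
    then show ?case using F G
      by (intro exI[of _ "F \<union> G"] exI[of _ "\<lambda>e. ?p e + ?q e"]) simp
  qed
  then obtain F p where F: "finite F" "F \<subseteq> B" "t = (\<Sum>e\<in>F. e \<otimes> p e)" by blast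
  have "p e = 0" if e: "e \<in> F" for e
  proof -
    let ?\<omega> = "\<lambda>a. complex_vector.representation B a e"
    have l: "clinear ?\<omega>"
      by (rule clinearI)
        (use B in \<open>simp_all add: complex_vector.representation_add
          complex_vector.representation_scale scaleC_complex_def\<close>)
    have "0 = slice_left ?\<omega> t" using assms[OF l] by simp
    also have "\<dots> = (\<Sum>f\<in>F. ?\<omega> f *\<^sub>C p f)"
      by (simp add: F(3) clinear_sum[OF clinear_slice_left[OF l]] slice_left_tensor[OF l])
    also have "\<dots> = (\<Sum>f\<in>F. if f = e then p f else 0)"
      by (rule sum.cong) (use F B in \<open>auto simp: complex_vector.representation_basis subset_iff scaleC_one\<close>)
    also have "\<dots> = p e" using F e by simp
    finally show ?thesis by simp
  qed
  then show ?thesis by (simp add: F(3) tensor_simps(4)[of _ 0 0, simplified])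
qed


lemma separating_functionals:
  fixes x :: "'a::complex_vector"
  assumes "\<And>\<omega>. clinear \<omega> \<Longrightarrow> \<omega> x = (0::complex)"
  shows "x = 0"
proof -
  have "x \<otimes> (1::complex) = 0"
    by (rule tensor_eq_0I) (simp add: slice_left_tensor assms)
  then have "slice_right id (x \<otimes> (1::complex)) = 0"
    by (simp add: clinear_0[OF clinear_slice_right] clinear_iff)
  then show ?thesis by (simp add: slice_right_tensor clinear_iff scaleC_one)
qed

lemma slice_swap:
  "clinear \<omega> \<Longrightarrow> clinear \<eta> \<Longrightarrow> \<eta> (slice_left \<omega> t) = \<omega> (slice_right \<eta> t)"
  by (induction t rule: tensor_induct)
    (simp_all add: clinear_add[OF clinear_slice_left] clinear_add[OF clinear_slice_right]
      slice_left_tensor slice_right_tensor clinear_add clinear_scaleC scaleC_complex_def)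

lemma inj_embed_tensor:
  assumes nl: "\<And>a::'a::complex_algebra. (\<forall>b. a * b = 0) \<Longrightarrow> a = 0"
    and nr: "\<And>a::'b::complex_algebra. (\<forall>b. a * b = 0) \<Longrightarrow> a = 0"
  shows "inj (embed :: ('a, 'b) tensor \<Rightarrow> _)"
proof (rule injI)
  fix s t :: "('a, 'b) tensor" assume "embed s = embed t"
  then have "lmul (embed s) u = lmul (embed t) u" for u by simp
  then have z: "(s - t) * u = 0" for u by (simp add: left_diff_distrib)
  define r where "r = s - t"
  have *: "slice_right \<omega> (r' * (c \<otimes> d)) = slice_right (\<lambda>b. \<omega> (b * d)) r' * c"
    if o: "clinear \<omega>" for \<omega> c d and r' :: "('a, 'b) tensor"
  proof -
    have l: "clinear (\<lambda>b. \<omega> (b * d))" by (rule clinear_compose[OF o clinear_mult_right])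
    show ?thesis
      by (induction r' rule: tensor_induct)
        (simp_all add: o l clinear_add[OF clinear_slice_right] slice_right_tensor tensor_mult
          distrib_right mult_scaleC_left)
  qed
  have 1: "slice_right (\<lambda>b. \<omega> (b * d)) r = 0" if o: "clinear \<omega>" for \<omega> d
    by (rule nl) (use *[OF o, of r _ d] z in \<open>simp add: r_def clinear_0[OF clinear_slice_right[OF o]]\<close>)
  have "slice_left \<eta> r * d = 0" if e: "clinear \<eta>" for \<eta> d
  proof (rule separating_functionals)
    fix \<omega> :: "'b \<Rightarrow> complex" assume o: "clinear \<omega>"
    have l: "clinear (\<lambda>b. \<omega> (b * d))" by (rule clinear_compose[OF o clinear_mult_right])
    show "\<omega> (slice_left \<eta> r * d) = 0"
      using slice_swap[OF e l, of r] 1[OF o] clinear_0[OF e] by simp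
  qed
  then have "slice_left \<eta> r = 0" if "clinear \<eta>" for \<eta> using nr that by blast
  then have "r = 0" by (rule tensor_eq_0I)
  then show "s = t" by (simp add: r_def)
qed

lemma clinear_embed: "clinear embed"
  by (rule clinearI; rule multiplier_eqI)
    (simp_all add: distrib_left distrib_right mult_scaleC_left mult_scaleC_right)

lemma embed_mult: "embed (x * y) = embed x * embed y"
  by (rule multiplier_eqI) (simp_all add: mult.assoc)

lemma mult_embed: "m * embed x = embed (lmul m x)"
  and embed_mult_multiplier: "embed x * m = embed (rmul m x)"
  by (rule multiplier_eqI; simp add: lmul_mult rmul_mult mult_lmul)+

lemma unembed_embed: "inj (embed :: 'a::complex_algebra \<Rightarrow> _) \<Longrightarrow> unembed (embed x) = (x::'a)"
  unfolding unembed_def by (rule the_equality) (auto simp: inj_eq)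

lemma mtensor_mult: "mtensor m n * mtensor m' n' = mtensor (m * m') (n * n')"
proof (rule multiplier_eqI)
  fix t
  note l = clinear_tensor_map[OF clinear_lmul clinear_lmul, THEN clinear_add]
    and r = clinear_tensor_map[OF clinear_rmul clinear_rmul, THEN clinear_add]
  show "lmul (mtensor m n * mtensor m' n') t = lmul (mtensor (m * m') (n * n')) t"
    by (induction t rule: tensor_induct)
      (simp_all add: lmul_mtensor l tensor_map_tensor clinear_lmul)
  show "rmul (mtensor m n * mtensor m' n') t = rmul (mtensor (m * m') (n * n')) t"
    by (induction t rule: tensor_induct)
      (simp_all add: rmul_mtensor r tensor_map_tensor clinear_rmul)
qed

lemma mtensor_embed: "mtensor (embed a) (embed b) = embed (a \<otimes> b)"
proof (rule multiplier_eqI)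
  fix t
  note l = clinear_tensor_map[OF clinear_lmul clinear_lmul, THEN clinear_add]
    and r = clinear_tensor_map[OF clinear_rmul clinear_rmul, THEN clinear_add]
  show "lmul (mtensor (embed a) (embed b)) t = lmul (embed (a \<otimes> b)) t"
    by (induction t rule: tensor_induct)
      (simp_all add: lmul_mtensor l tensor_map_tensor clinear_lmul tensor_mult distrib_left)
  show "rmul (mtensor (embed a) (embed b)) t = rmul (embed (a \<otimes> b)) t"
    by (induction t rule: tensor_induct)
      (simp_all add: rmul_mtensor r tensor_map_tensor clinear_rmul tensor_mult distrib_right)
qed

lemma slice_right_lmul:
  assumes "clinear \<omega>"
  shows "slice_right \<omega> (lmul (mtensor m 1) t) = lmul m (slice_right \<omega> t)"
    "slice_right \<omega> (rmul (mtensor m 1) t) = rmul m (slice_right \<omega> t)"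
  by (induction t rule: tensor_induct,
      simp_all add: lmul_mtensor rmul_mtensor tensor_map_tensor clinear_lmul clinear_rmul assms
        slice_right_tensor clinear_scaleC[OF clinear_lmul] clinear_scaleC[OF clinear_rmul]
        clinear_add[OF clinear_lmul] clinear_add[OF clinear_rmul]
        clinear_add[OF clinear_slice_right]
        clinear_add[OF clinear_tensor_map[OF clinear_lmul clinear_lmul]]
        clinear_add[OF clinear_tensor_map[OF clinear_rmul clinear_rmul]])

lemma slice_left_lmul:
  assumes "clinear \<omega>"
  shows "slice_left \<omega> (lmul (mtensor 1 m) t) = lmul m (slice_left \<omega> t)"
    "slice_left \<omega> (rmul (mtensor 1 m) t) = rmul m (slice_left \<omega> t)"
  by (induction t rule: tensor_induct,
      simp_all add: lmul_mtensor rmul_mtensor tensor_map_tensor clinear_lmul clinear_rmul assms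
        slice_left_tensor clinear_scaleC[OF clinear_lmul] clinear_scaleC[OF clinear_rmul]
        clinear_add[OF clinear_lmul] clinear_add[OF clinear_rmul]
        clinear_add[OF clinear_slice_left]
        clinear_add[OF clinear_tensor_map[OF clinear_lmul clinear_lmul]]
        clinear_add[OF clinear_tensor_map[OF clinear_rmul clinear_rmul]])


lemma mtensor_cong_tensor:
  assumes "\<And>a b. lmul m (a \<otimes> b) = lmul n (a \<otimes> b)" "\<And>a b. rmul m (a \<otimes> b) = rmul n (a \<otimes> b)"
  shows "m = n"
  by (rule multiplier_eqI; rule tensor_ext) (simp_all add: clinear_lmul clinear_rmul assms)

lemma cbilinear_mtensor: "cbilinear mtensor"
  by (rule cbilinearI; rule mtensor_cong_tensor)
    (simp_all add: lmul_mtensor rmul_mtensor tensor_map_tensor clinear_lmul clinear_rmul tensor_simps)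

context regular_multiplier_hopf_algebra
begin

lemma inj_embed: "inj (embed :: 'a \<Rightarrow> _)"
proof (rule injI)
  fix x y :: 'a assume "embed x = embed y"
  then have "lmul (embed x) a = lmul (embed y) a" for a by simp
  then have "\<forall>a. (x - y) * a = 0" by (simp add: left_diff_distrib)
  then show "x = y" using nondegenerate_left by fastforce
qed

lemma inj_embed2: "inj (embed :: ('a, 'a) tensor \<Rightarrow> _)"
  by (rule inj_embed_tensor) (fact nondegenerate_left)+

lemma embed_unembed: "m \<in> range embed \<Longrightarrow> embed (unembed m) = (m :: ('a, 'a) tensor multiplier)"
  using unembed_embed[OF inj_embed2] by auto

lemma unembed_arith:
  fixes m n :: "('a, 'a) tensor multiplier"
  assumes "m \<in> range embed" "n \<in> range embed"
  shows "unembed (m + n) = unembed m + unembed n" "unembed (c *\<^sub>C m) = c *\<^sub>C unembed m"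
    "unembed (m * l) = rmul l (unembed m)" "unembed (l * m) = lmul l (unembed m)"
  using assms unembed_embed[OF inj_embed2]
  by (auto simp flip: clinear_add[OF clinear_embed] clinear_scaleC[OF clinear_embed]
      simp: mult_embed embed_mult_multiplier)

lemma mslice_right:
  assumes \<omega>: "clinear \<omega>"
  shows "lmul (mslice_right \<omega> (\<Delta> x)) a = slice_right \<omega> (unembed (\<Delta> x * mtensor (embed a) 1))"
    and "rmul (mslice_right \<omega> (\<Delta> x)) a = slice_right \<omega> (unembed (mtensor (embed a) 1 * \<Delta> x))"
proof -
  let ?L = "\<lambda>a. slice_right \<omega> (unembed (\<Delta> x * mtensor (embed a) 1))"
  let ?R = "\<lambda>a. slice_right \<omega> (unembed (mtensor (embed a) 1 * \<Delta> x))"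
  note lin = cbilinearD[OF cbilinear_mtensor] clinear_add[OF clinear_embed]
    clinear_scaleC[OF clinear_embed] clinear_add[OF clinear_slice_right[OF \<omega>]]
    clinear_scaleC[OF clinear_slice_right[OF \<omega>]] unembed_arith(1,2)[OF range3 range3]
    unembed_arith(1,2)[OF range2 range2]
  have "clinear ?L" "clinear ?R"
    by (rule clinearI;
        simp add: lin distrib_left distrib_right mult_scaleC_left mult_scaleC_right)+
  moreover have L: "?L (a * b) = ?L a * b" for a b
  proof -
    have "\<Delta> x * mtensor (embed (a * b)) 1 = \<Delta> x * mtensor (embed a) 1 * mtensor (embed b) 1"
      by (simp add: mult.assoc mtensor_mult embed_mult)
    then show ?thesis
      by (simp add: unembed_arith(3)[OF range3 range3] slice_right_lmul[OF \<omega>])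
  qed
  moreover have R: "?R (a * b) = a * ?R b" for a b
  proof -
    have "mtensor (embed (a * b)) 1 * \<Delta> x = mtensor (embed a) 1 * (mtensor (embed b) 1 * \<Delta> x)"
      by (simp add: mtensor_mult embed_mult flip: mult.assoc)
    then show ?thesis
      by (simp add: unembed_arith(4)[OF range2 range2] slice_right_lmul[OF \<omega>])
  qed
  moreover have "a * ?L b = ?R a * b" for a b
  proof -
    have "a * ?L b = slice_right \<omega> (unembed (mtensor (embed a) 1 * (\<Delta> x * mtensor (embed b) 1)))"
      by (simp add: unembed_arith(4)[OF range3 range3] slice_right_lmul[OF \<omega>])
    also have "mtensor (embed a) 1 * (\<Delta> x * mtensor (embed b) 1)
        = mtensor (embed a) 1 * \<Delta> x * mtensor (embed b) 1"
      by (simp only: mult.assoc)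
    also have "slice_right \<omega> (unembed \<dots>) = ?R a * b"
      by (simp add: unembed_arith(3)[OF range2 range2] slice_right_lmul[OF \<omega>])
    finally show ?thesis .
  qed
  ultimately have m: "is_multiplier ?L ?R" by (simp add: is_multiplier_def)
  have "\<exists>!n. \<forall>a. lmul n a = ?L a \<and> rmul n a = ?R a"
  proof (rule ex1I[of _ "Abs_multiplier (?L, ?R)"])
    show "\<forall>a. lmul (Abs_multiplier (?L, ?R)) a = ?L a \<and> rmul (Abs_multiplier (?L, ?R)) a = ?R a"
      using m by (simp add: lmul.rep_eq rmul.rep_eq Abs_multiplier_inverse)
    then show "n = Abs_multiplier (?L, ?R)" if "\<forall>a. lmul n a = ?L a \<and> rmul n a = ?R a" for n
      using that by (intro multiplier_eqI) metis+
  qed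
  from theI'[OF this] show "lmul (mslice_right \<omega> (\<Delta> x)) a = ?L a"
    "rmul (mslice_right \<omega> (\<Delta> x)) a = ?R a"
    by (simp_all add: mslice_right_def)
qed

lemma cbilinear_canonical1: "cbilinear (\<lambda>a a'. unembed (\<Delta> a * mtensor 1 (embed a')))"
  by (rule cbilinearI)
    (simp_all add: clinear_add[OF clinear_coproduct] clinear_scaleC[OF clinear_coproduct]
      cbilinearD[OF cbilinear_mtensor] clinear_add[OF clinear_embed] clinear_scaleC[OF clinear_embed]
      distrib_left distrib_right mult_scaleC_left mult_scaleC_right
      unembed_arith(1,2)[OF range1 range1])

lemma eq_on_canonical1:
  assumes f: "clinear f" and g: "clinear g"
    and eq: "\<And>a a'. f (unembed (\<Delta> a * mtensor 1 (embed a')))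
      = g (unembed (\<Delta> a * mtensor 1 (embed a')))"
  shows "f t = g t"
proof -
  have c: "clinear (canonical_map1 \<Delta>)"
    by (simp add: canonical_map1_def clinear_tensor_lift cbilinear_canonical1)
  obtain s where s: "t = canonical_map1 \<Delta> s" using bij1 by (metis bij_pointE)
  have "f (canonical_map1 \<Delta> s) = g (canonical_map1 \<Delta> s)"
    by (rule tensor_ext[OF clinear_compose[OF f c] clinear_compose[OF g c]])
      (simp add: canonical_map1_def tensor_lift_tensor[OF cbilinear_canonical1] eq)
  then show ?thesis by (simp add: s)
qed

text \<open>The counit and the antipode are uniquely determined.\<close>

lemma is_counit_unique:
  assumes "is_counit \<Delta> \<epsilon>" "is_counit \<Delta> \<epsilon>'"
  shows "\<epsilon> = \<epsilon>'"
proof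
  fix a
  have l: "clinear \<epsilon>" "clinear \<epsilon>'" using assms by (auto simp: is_counit_def)
  have "slice_left \<epsilon> t = slice_left \<epsilon>' t" for t :: "('a, 'a) tensor"
    by (rule eq_on_canonical1[of "slice_left \<epsilon>" "slice_left \<epsilon>'"])
      (use assms in \<open>simp_all add: is_counit_def clinear_slice_left\<close>)
  then have "slice_left \<epsilon> (a \<otimes> a) = slice_left \<epsilon>' (a \<otimes> a)" .
  then have "a = 0 \<or> \<epsilon> a = \<epsilon>' a" by (auto simp: slice_left_tensor l)
  then show "\<epsilon> a = \<epsilon>' a" using clinear_0[OF l(1)] clinear_0[OF l(2)] by auto
qed

lemma is_antipode_unique:
  assumes "is_antipode \<Delta> \<epsilon> S" "is_antipode \<Delta> \<epsilon> S'"
  shows "S = S'"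
proof
  fix a
  have l: "clinear S" "clinear S'" using assms by (auto simp: is_antipode_def)
  have bil: "cbilinear (\<lambda>p q. T p * q)" if "clinear T" for T :: "'a \<Rightarrow> 'a"
    by (rule cbilinearI)
      (simp_all add: clinear_add[OF that] clinear_scaleC[OF that] distrib_left distrib_right
        mult_scaleC_left mult_scaleC_right)
  have "tensor_lift (\<lambda>p q. S p * q) t = tensor_lift (\<lambda>p q. S' p * q) t" for t
    by (rule eq_on_canonical1[of "tensor_lift (\<lambda>p q. S p * q)" "tensor_lift (\<lambda>p q. S' p * q)"])
      (use assms in \<open>simp_all add: is_antipode_def clinear_tensor_lift bil\<close>)
  then have "tensor_lift (\<lambda>p q. S p * q) (a \<otimes> b) = tensor_lift (\<lambda>p q. S' p * q) (a \<otimes> b)" for b .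
  then have "\<forall>b. (S a - S' a) * b = 0"
    by (simp add: tensor_lift_tensor bil l left_diff_distrib)
  then show "S a = S' a" using nondegenerate_left by fastforce
qed

text \<open>For \<open>b = \<phi>(\<cdot> c)\<close> and \<open>b' = \<phi>(\<cdot> c')\<close> the slice \<open>(\<iota> \<otimes> b) \<Delta>(x)\<close> lies in \<open>A\<close>, and \<open>b b'\<close> is
  \<open>a \<mapsto> (\<phi> \<otimes> \<phi>) (\<Delta>(a) (c \<otimes> c'))\<close>.\<close>

lemma mslice_right_dual:
  assumes \<phi>: "clinear \<phi>"
  shows "mslice_right (\<lambda>a. \<phi> (a * c)) (\<Delta> x)
    = embed (slice_right \<phi> (unembed (\<Delta> x * mtensor 1 (embed c))))"
proof -
  let ?b = "\<lambda>a. \<phi> (a * c)"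
  have b: "clinear ?b" by (rule clinear_compose[OF \<phi> clinear_mult_right])
  have s: "slice_right ?b t = slice_right \<phi> (rmul (mtensor 1 (embed c)) t)" for t :: "('a, 'a) tensor"
    by (induction t rule: tensor_induct)
      (simp_all add: rmul_mtensor tensor_map_tensor clinear_rmul b \<phi> slice_right_tensor
        clinear_add[OF clinear_slice_right]
        clinear_add[OF clinear_tensor_map[OF clinear_rmul clinear_rmul]])
  have c: "mtensor (embed a) 1 * mtensor 1 (embed c) = mtensor 1 (embed c) * mtensor (embed a) 1"
    for a by (simp add: mtensor_mult)
  show ?thesis
  proof (rule multiplier_eqI)
    fix a
    have "lmul (mslice_right ?b (\<Delta> x)) a
        = slice_right \<phi> (unembed (\<Delta> x * mtensor (embed a) 1 * mtensor 1 (embed c)))"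
      by (simp add: mslice_right[OF b] s unembed_arith(3)[OF range3 range3])
    also have "\<Delta> x * mtensor (embed a) 1 * mtensor 1 (embed c)
        = \<Delta> x * mtensor 1 (embed c) * mtensor (embed a) 1"
      by (simp only: mult.assoc c)
    also have "slice_right \<phi> (unembed \<dots>)
        = lmul (embed (slice_right \<phi> (unembed (\<Delta> x * mtensor 1 (embed c))))) a"
      by (simp add: unembed_arith(3)[OF range1 range1] slice_right_lmul[OF \<phi>])
    finally show "lmul (mslice_right ?b (\<Delta> x)) a = \<dots>" .
    have "rmul (mslice_right ?b (\<Delta> x)) a
        = slice_right \<phi> (unembed (mtensor (embed a) 1 * \<Delta> x * mtensor 1 (embed c)))"
      by (simp add: mslice_right[OF b] s unembed_arith(3)[OF range2 range2])
    also have "\<dots> = rmul (embed (slice_right \<phi> (unembed (\<Delta> x * mtensor 1 (embed c))))) a"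
      by (simp add: mult.assoc unembed_arith(4)[OF range1 range1] slice_right_lmul[OF \<phi>])
    finally show "rmul (mslice_right ?b (\<Delta> x)) a = \<dots>" .
  qed
qed

lemma dual_act_eq:
  "clinear \<phi> \<Longrightarrow> dual_act \<Delta> (\<lambda>a. \<phi> (a * c)) x
    = slice_right \<phi> (unembed (\<Delta> x * mtensor 1 (embed c)))"
  by (simp add: dual_act_def mslice_right_dual unembed_embed[OF inj_embed])

lemma dual_mult_eq:
  assumes \<phi>: "clinear \<phi>"
  shows "dual_mult \<Delta> (\<lambda>a. \<phi> (a * c)) (\<lambda>a. \<phi> (a * c')) a
    = tensor_lift (\<lambda>p q. \<phi> p * \<phi> q) (lmul (\<Delta> a) (c \<otimes> c'))"
proof -
  have bil: "cbilinear (\<lambda>p q. \<phi> p * \<phi> q)"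
    by (rule cbilinearI)
      (simp_all add: clinear_add[OF \<phi>] clinear_scaleC[OF \<phi>] scaleC_complex_def algebra_simps)
  have l: "\<phi> (slice_right \<phi> t) = tensor_lift (\<lambda>p q. \<phi> p * \<phi> q) t" for t
    by (induction t rule: tensor_induct)
      (simp_all add: slice_right_tensor[OF \<phi>] clinear_scaleC[OF \<phi>] tensor_lift_tensor[OF bil]
        clinear_add[OF clinear_slice_right[OF \<phi>]] clinear_add[OF \<phi>]
        clinear_add[OF clinear_tensor_lift[OF bil]] scaleC_complex_def)
  have "embed (rmul (mtensor (embed c) 1) (unembed (\<Delta> a * mtensor 1 (embed c'))))
      = \<Delta> a * mtensor 1 (embed c') * mtensor (embed c) 1"
    by (simp add: embed_unembed[OF range1] flip: embed_mult_multiplier)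
  also have "\<dots> = embed (lmul (\<Delta> a) (c \<otimes> c'))"
    by (simp add: mult.assoc mtensor_mult mtensor_embed mult_embed)
  finally have "rmul (mtensor (embed c) 1) (unembed (\<Delta> a * mtensor 1 (embed c')))
      = lmul (\<Delta> a) (c \<otimes> c')"
    by (rule injD[OF inj_embed2])
  then show ?thesis
    using slice_right_lmul(2)[OF \<phi>, of "embed c" "unembed (\<Delta> a * mtensor 1 (embed c'))"]
    by (simp add: dual_mult_def tensor_pairing_def mslice_right_dual[OF \<phi>]
        unembed_embed[OF inj_embed] flip: l)
qed

end

end

theory Submission
  imports Defs
begin

text \<open>In Sweedler notation, \<open>\<Delta>(a) = a\<^sub>1 \<otimes> a\<^sub>2\<close>, the first formula says
  \<open>S(S\<^sup>-\<^sup>1(a) a') = S(a') a\<close>. The second one is strong right invariance of \<open>\<psi>\<close>: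
  \<open>a\<^sub>1 \<psi>(S(a\<^sub>2) x) = \<psi>(S(a) x\<^sub>1) x\<^sub>2\<close>. Applying \<open>b\<close> to the left-hand side gives the
  product \<open>b \<F>(x)\<close> at \<open>a\<close>, applying \<open>b\<close> to the right-hand side gives
  \<open>\<psi>(S(a) (b \<triangleright> x)) = \<F>(b \<triangleright> x)(a)\<close>.

  To obtain strong invariance, replace the scalar \<open>\<psi>(y)\<close>, for \<open>y = S(a\<^sub>2) x\<close>, by
  \<open>(\<psi> \<otimes> \<iota>) \<Delta>(y)\<close> and split \<open>\<Delta>(y) = \<Delta>(S(a\<^sub>2)) \<Delta>(x)\<close>. The claim then follows from
  \<open>(1 \<otimes> a\<^sub>1) \<Delta>(S(a\<^sub>2)) = S(a) \<otimes> 1\<close> (lemma \<open>antipode_coproduct\<close>), which is where the antipode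
  reverses the coproduct. It suffices to prove this after multiplying by \<open>\<Delta>(c)(1 \<otimes> d)\<close> on the
  right. Both sides depend linearly on \<open>a \<otimes> c\<close>, so \<open>a \<otimes> c\<close> may be replaced by
  \<open>\<Delta>(e)(1 \<otimes> f) = e\<^sub>1 \<otimes> e\<^sub>2 f\<close>, because these elements span \<open>A \<otimes> A\<close>. On the left,
  \<open>S(e\<^sub>2) e\<^sub>3 f\<close> collapses to \<open>\<epsilon>(e\<^sub>2) f\<close>; on the right, \<open>S(e\<^sub>1) e\<^sub>2 f\<^sub>1 \<otimes> e\<^sub>3 f\<^sub>2\<close>
  collapses to \<open>f\<^sub>1 \<otimes> e f\<^sub>2\<close>, and both are \<open>(1 \<otimes> e) \<Delta>(f)\<close>.

  As \<open>A\<close> need not have a unit and \<open>\<Delta>\<close> takes values in multipliers, each such expression has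
  to be covered by a factor that brings it into a tensor power of \<open>A\<close>, like the \<open>z\<close> in
  \<open>z a\<^sub>1 \<otimes> S(a\<^sub>2)\<close>. A covered Sweedler expression
  is a term \<open>tensor_lift (\<lambda>p q. F p q) t\<close>, to be read as the sum of \<open>F p q\<close> over the summands
  \<open>p \<otimes> q\<close> of \<open>t\<close>, where \<open>t\<close> is \<open>\<Delta>(a)(1 \<otimes> b)\<close> or \<open>(a \<otimes> 1)\<Delta>(c)\<close>.\<close>

section \<open>Multilinear sums over tensors\<close>

text \<open>Introduction rules that split the linearity of a compound expression along its
  syntax; they discharge the side conditions of the manipulations of sums.\<close>

named_theorems multilinear

lemma cbilinearI' [multilinear]:
  assumes "\<And>b. clinear (\<lambda>a. f a b)" "\<And>a. clinear (\<lambda>b. f a b)"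
  shows "cbilinear f"
  using assms by (simp add: cbilinear_def)

lemma clinear_ident [multilinear]: "clinear (\<lambda>x. x)"
  by (simp add: clinear_iff)

lemma clinear_mult_intros [multilinear]:
  fixes f :: "'a::complex_vector \<Rightarrow> 'b::complex_algebra"
  assumes "clinear f"
  shows "clinear (\<lambda>x. f x * y)" "clinear (\<lambda>x. y * f x)"
  using assms by (simp_all add: clinear_iff distrib_left distrib_right mult_scaleC_left mult_scaleC_right)

lemma clinear_tensor_intros [multilinear]:
  assumes "clinear f"
  shows "clinear (\<lambda>x. f x \<otimes> y)" "clinear (\<lambda>x. y \<otimes> f x)"
  using assms by (simp_all add: clinear_iff tensor_simps)

lemma clinear_scaleC_intros [multilinear]:
  shows "clinear f \<Longrightarrow> clinear (\<lambda>x. f x *\<^sub>C y)" "clinear g \<Longrightarrow> clinear (\<lambda>x. c *\<^sub>C g x)"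
  by (simp_all add: clinear_iff scaleC_add_left scaleC_add_right scaleC_scaleC scaleC_complex_def mult.commute)

lemma clinear_tensor_lift_arg [multilinear]:
  "cbilinear g \<Longrightarrow> clinear f \<Longrightarrow> clinear (\<lambda>x. tensor_lift g (f x))"
  by (rule clinear_compose[OF clinear_tensor_lift])

lemma clinear_tensor_lift_fun [multilinear]:
  assumes g: "\<And>x. cbilinear (g x)" and l: "\<And>p q. clinear (\<lambda>x. g x p q)"
  shows "clinear (\<lambda>x. tensor_lift (g x) t)"
proof (induction t rule: tensor_induct)
  case (tensor a b)
  then show ?case by (simp add: tensor_lift_tensor g l)
next
  case (add s t)
  then show ?case
    by (simp add: clinear_add[OF clinear_tensor_lift[OF g]] clinear_iff scaleC_add_right)
qed

lemma clinear_lmul_intro [multilinear]: "clinear f \<Longrightarrow> clinear (\<lambda>x. lmul m (f x))"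
  and clinear_rmul_intro [multilinear]: "clinear f \<Longrightarrow> clinear (\<lambda>x. rmul m (f x))"
  by (rule clinear_compose[OF clinear_lmul], assumption)
    (rule clinear_compose[OF clinear_rmul], assumption)

text \<open>Linear maps may be moved inside a sum.\<close>

lemma clinear_tensor_lift_fusion:
  assumes h: "clinear h" and g: "cbilinear g"
  shows "h (tensor_lift g t) = tensor_lift (\<lambda>p q. h (g p q)) t"
proof -
  have b: "cbilinear (\<lambda>p q. h (g p q))"
    by (rule cbilinearI) (simp_all add: cbilinearD[OF g] clinear_add[OF h] clinear_scaleC[OF h])
  show ?thesis
    by (rule tensor_ext[OF clinear_compose[OF h clinear_tensor_lift[OF g]] clinear_tensor_lift[OF b]])
      (simp add: tensor_lift_tensor g b)
qed

lemma tensor_lift_swap: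
  assumes "\<And>p q. cbilinear (F p q)" "\<And>r s. cbilinear (\<lambda>p q. F p q r s)"
  shows "tensor_lift (\<lambda>p q. tensor_lift (F p q) t) u
    = tensor_lift (\<lambda>r s. tensor_lift (\<lambda>p q. F p q r s) u) t"
proof (induction u rule: tensor_induct)
  case (tensor a b)
  have "cbilinear (\<lambda>p q. tensor_lift (F p q) t)"
    by (intro cbilinearI' clinear_tensor_lift_fun assms)
      (use assms in \<open>simp_all add: cbilinear_def\<close>)
  then show ?case
    by (simp add: tensor_lift_tensor assms)
next
  case (add u v)
  have "cbilinear (\<lambda>p q. tensor_lift (F p q) t)"
    by (intro cbilinearI' clinear_tensor_lift_fun assms)
      (use assms in \<open>simp_all add: cbilinear_def\<close>)
  moreover have "cbilinear (\<lambda>r s. tensor_lift (\<lambda>p q. F p q r s) w)" for w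
    by (intro cbilinearI' clinear_tensor_lift_fun assms)
      (use assms in \<open>simp_all add: cbilinear_def\<close>)
  moreover have "tensor_lift (\<lambda>r s. f r s + g r s) t = tensor_lift f t + tensor_lift g t"
    if f: "cbilinear f" and g: "cbilinear g" for f g :: "'c \<Rightarrow> 'd \<Rightarrow> 'e"
  proof -
    have b: "cbilinear (\<lambda>r s. f r s + g r s)"
      by (rule cbilinearI) (simp_all add: cbilinearD[OF f] cbilinearD[OF g] scaleC_add_right)
    show ?thesis
      by (induction t rule: tensor_induct)
        (simp_all add: tensor_lift_tensor f g b clinear_add[OF clinear_tensor_lift])
  qed
  ultimately show ?case
    using add by (simp add: clinear_add[OF clinear_tensor_lift] assms)
qed

lemma tensor_lift_tensor_id: "tensor_lift (\<otimes>) t = t"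
  by (induction t rule: tensor_induct)
    (simp_all add: tensor_lift_tensor cbilinear_tensor clinear_add[OF clinear_tensor_lift])

lemma tensor_lift_lmul_rmul:
  assumes F: "cbilinear F"
  shows "tensor_lift F (lmul (mtensor m n) t) = tensor_lift (\<lambda>p q. F (lmul m p) (lmul n q)) t"
    and "tensor_lift F (rmul (mtensor m n) t) = tensor_lift (\<lambda>p q. F (rmul m p) (rmul n q)) t"
proof -
  note D = cbilinearD[OF F] clinear_add[OF clinear_lmul] clinear_add[OF clinear_rmul]
    clinear_scaleC[OF clinear_lmul] clinear_scaleC[OF clinear_rmul]
  have b: "cbilinear (\<lambda>p q. F (lmul m p) (lmul n q))" "cbilinear (\<lambda>p q. F (rmul m p) (rmul n q))"
    by (rule cbilinearI; simp add: D)+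
  show "tensor_lift F (lmul (mtensor m n) t) = tensor_lift (\<lambda>p q. F (lmul m p) (lmul n q)) t"
    by (rule tensor_ext) (auto intro!: multilinear b F clinear_tensor_map clinear_lmul
        simp: lmul_mtensor tensor_map_tensor clinear_lmul tensor_lift_tensor b F)
  show "tensor_lift F (rmul (mtensor m n) t) = tensor_lift (\<lambda>p q. F (rmul m p) (rmul n q)) t"
    by (rule tensor_ext) (auto intro!: multilinear b F clinear_tensor_map clinear_rmul
        simp: rmul_mtensor tensor_map_tensor clinear_rmul tensor_lift_tensor b F)
qed

text \<open>If the maps \<open>f\<^sub>i\<close> are jointly injective on \<open>A\<close>, then so are \<open>f\<^sub>i \<otimes> \<iota>\<close> on \<open>A \<otimes> V\<close>, since
  slicing the second leg with a functional commutes with \<open>f\<^sub>i\<close> on the first, and slices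
  detect zero. This is what permits cancelling a covering factor from one leg of a tensor.\<close>

lemma separating_family_tensor_left:
  fixes t :: "('a::complex_vector, 'b::complex_vector) tensor"
  assumes f: "\<And>i. clinear (f i)" and sep: "\<And>a::'a. (\<And>i. f i a = 0) \<Longrightarrow> a = 0"
    and t: "\<And>i. tensor_lift (\<lambda>p q. f i p \<otimes> q) t = 0"
  shows "t = 0"
proof (rule tensor_eq_0I, rule separating_functionals)
  fix \<omega> :: "'a \<Rightarrow> complex" and \<eta> :: "'b \<Rightarrow> complex"
  assume o: "clinear \<omega>" and e: "clinear \<eta>"
  have b: "cbilinear (\<lambda>p q. f i p \<otimes> q)" for i
    by (intro multilinear f)
  have "f i (slice_right \<eta> t) = slice_right \<eta> (tensor_lift (\<lambda>p q. f i p \<otimes> q) t)" for i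
    by (rule tensor_ext[where f = "\<lambda>t. f i (slice_right \<eta> t)"])
      (simp_all add: clinear_compose[OF f clinear_slice_right[OF e]]
        clinear_compose[OF clinear_slice_right[OF e] clinear_tensor_lift[OF b]]
        slice_right_tensor e tensor_lift_tensor[OF b] clinear_scaleC[OF f])
  then have "slice_right \<eta> t = 0"
    by (intro sep) (simp add: t clinear_0[OF clinear_slice_right[OF e]])
  then show "\<eta> (slice_left \<omega> t) = 0"
    by (simp add: slice_swap o e clinear_0[OF o])
qed

lemma separating_family_tensor_right:
  fixes t :: "('a::complex_vector, 'b::complex_vector) tensor"
  assumes f: "\<And>i. clinear (f i)" and sep: "\<And>b::'b. (\<And>i. f i b = 0) \<Longrightarrow> b = 0"
    and t: "\<And>i. tensor_lift (\<lambda>p q. p \<otimes> f i q) t = 0"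
  shows "t = 0"
proof (rule tensor_eq_0I)
  fix \<omega> :: "'a \<Rightarrow> complex"
  assume o: "clinear \<omega>"
  have b: "cbilinear (\<lambda>p q. p \<otimes> f i q)" for i
    by (intro multilinear f)
  have "f i (slice_left \<omega> t) = slice_left \<omega> (tensor_lift (\<lambda>p q. p \<otimes> f i q) t)" for i
    by (rule tensor_ext[where f = "\<lambda>t. f i (slice_left \<omega> t)"])
      (simp_all add: clinear_compose[OF f clinear_slice_left[OF o]]
        clinear_compose[OF clinear_slice_left[OF o] clinear_tensor_lift[OF b]]
        slice_left_tensor o tensor_lift_tensor[OF b] clinear_scaleC[OF f])
  then show "slice_left \<omega> t = 0"
    by (intro sep) (simp add: t clinear_0[OF clinear_slice_left[OF o]])
qed

text \<open>Multiplication by \<open>c \<otimes> d\<close> is multiplication by \<open>c\<close> in the first leg followed by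
  multiplication by \<open>d\<close> in the second, and each of them can be cancelled.\<close>

lemma nondegenerate_left_tensor:
  fixes t :: "('a::complex_algebra, 'b::complex_algebra) tensor"
  assumes a: "\<And>a::'a. (\<forall>b. a * b = 0) \<Longrightarrow> a = 0" and b: "\<And>a::'b. (\<forall>b. a * b = 0) \<Longrightarrow> a = 0"
    and t: "\<And>u. t * u = 0"
  shows "t = 0"
proof (rule separating_family_tensor_left[where f = "\<lambda>c p. p * c"])
  show "clinear (\<lambda>p. p * c)" for c :: 'a by (intro multilinear)
  show "p = 0" if "\<And>c. p * c = 0" for p :: 'a using a that by blast
  fix c
  show "tensor_lift (\<lambda>p q. (p * c) \<otimes> q) t = 0"
  proof (rule separating_family_tensor_right[where f = "\<lambda>d q. q * d"])
    show "clinear (\<lambda>p. p * c)" for c :: 'b by (intro multilinear)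
    show "p = 0" if "\<And>c. p * c = 0" for p :: 'b using b that by blast
    fix d
    have b1: "cbilinear (\<lambda>p q. (p::'a) \<otimes> ((q::'b) * d))" 
      and b2: "cbilinear (\<lambda>p q. ((p::'a) * c) \<otimes> (q::'b))" by (intro multilinear)+
    have "tensor_lift (\<lambda>p q. p \<otimes> (q * d)) (tensor_lift (\<lambda>p q. (p * c) \<otimes> q) t) = t * (c \<otimes> d)"
      by (rule tensor_ext[where f = "\<lambda>t. tensor_lift _ (tensor_lift _ t)"])
        (auto intro!: multilinear simp: tensor_lift_tensor b1 b2 tensor_mult)
    then show "tensor_lift (\<lambda>p q. p \<otimes> (q * d)) (tensor_lift (\<lambda>p q. (p * c) \<otimes> q) t) = 0"
      by (simp add: t)
  qed
qed

lemma multiplier_map_embed: "algebra_iso f \<Longrightarrow> multiplier_map f (embed t) = embed (f t)"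
  by (rule multiplier_eqI)
    (simp_all add: lmul_multiplier_map rmul_multiplier_map algebra_iso_def bij_is_surj surj_f_inv_f)

section \<open>Covered coproducts and coassociativity\<close>

context regular_multiplier_hopf_algebra
begin

text \<open>The covered coproducts \<open>\<Delta>(a)(1 \<otimes> b)\<close>, \<open>(a \<otimes> 1)\<Delta>(c)\<close> and \<open>(1 \<otimes> p)\<Delta>(y)\<close>; as linear
  maps on \<open>A \<otimes> A\<close> the first two are the canonical maps.\<close>

definition T1 :: "'a \<Rightarrow> 'a \<Rightarrow> ('a, 'a) tensor" where
  "T1 a b = unembed (\<Delta> a * mtensor 1 (embed b))"

definition T2 :: "'a \<Rightarrow> 'a \<Rightarrow> ('a, 'a) tensor" where
  "T2 a c = unembed (mtensor (embed a) 1 * \<Delta> c)"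

definition T4 :: "'a \<Rightarrow> 'a \<Rightarrow> ('a, 'a) tensor" where
  "T4 p y = unembed (mtensor 1 (embed p) * \<Delta> y)"

lemma embed_T: "embed (T1 a b) = \<Delta> a * mtensor 1 (embed b)"
  "embed (T2 a b) = mtensor (embed a) 1 * \<Delta> b"
  "embed (T4 a b) = mtensor 1 (embed a) * \<Delta> b"
  by (simp_all add: T1_def T2_def T4_def embed_unembed range1 range2 range4)

lemma cbilinear_T: "cbilinear T1" "cbilinear T2" "cbilinear T4"
  by (rule cbilinearI; rule injD[OF inj_embed2];
      simp add: embed_T clinear_add[OF clinear_coproduct] clinear_scaleC[OF clinear_coproduct]
      cbilinearD[OF cbilinear_mtensor] clinear_add[OF clinear_embed] clinear_scaleC[OF clinear_embed]
      distrib_left distrib_right mult_scaleC_left mult_scaleC_right)+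

lemma clinear_T [multilinear]:
  assumes "clinear f"
  shows "clinear (\<lambda>x. T1 (f x) y)" "clinear (\<lambda>x. T1 y (f x))"
    "clinear (\<lambda>x. T2 (f x) y)" "clinear (\<lambda>x. T2 y (f x))"
    "clinear (\<lambda>x. T4 (f x) y)" "clinear (\<lambda>x. T4 y (f x))"
  using assms cbilinear_T by (auto simp: clinear_iff cbilinear_def)

text \<open>A form of induction over \<open>A \<otimes> A\<close>: surjectivity of the first canonical map allows
  \<open>a \<otimes> c\<close> to be replaced by \<open>e\<^sub>1 \<otimes> e\<^sub>2 f\<close>.\<close>

lemma eq_on_T1:
  assumes "cbilinear F" "cbilinear G"
    and "\<And>e f. tensor_lift F (T1 e f) = tensor_lift G (T1 e f)"
  shows "F a c = G a c"
  using eq_on_canonical1[OF clinear_tensor_lift clinear_tensor_lift, of F G "a \<otimes> c"] assms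
  by (simp add: T1_def tensor_lift_tensor)

text \<open>Both sides of the coassociativity axiom are multipliers that come from elements of the
  threefold tensor product; as that algebra is non-degenerate, the elements themselves agree.\<close>

lemma coassociative_tensor:
  "tensor_assoc (tensor_lift (\<lambda>p q. T2 a p \<otimes> q) (T1 c b))
    = tensor_lift (\<lambda>p q. p \<otimes> T1 q b) (T2 a c)"
proof -
  note D = cbilinearD[OF cbilinear_mtensor] clinear_add[OF clinear_coproduct]
    clinear_scaleC[OF clinear_coproduct] clinear_add[OF clinear_embed] clinear_scaleC[OF clinear_embed]
  have b1: "cbilinear (\<lambda>p q. mtensor (\<Delta> p) (embed q))"
    and b2: "cbilinear (\<lambda>p q. mtensor (embed p) (\<Delta> q))"
    by (rule cbilinearI; simp add: D)+
  have l1: "clinear (\<lambda>m. mtensor (mtensor (embed a) 1) 1 * m)"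
    and l2: "clinear (\<lambda>m. m * mtensor 1 (mtensor 1 (embed b)))"
    by (intro multilinear)+
  have L: "mtensor (mtensor (embed a) 1) 1 * tensor_lift (\<lambda>p q. mtensor (\<Delta> p) (embed q)) t
      = embed (tensor_lift (\<lambda>p q. T2 a p \<otimes> q) t)" for t
    by (subst clinear_tensor_lift_fusion[OF l1 b1], subst clinear_tensor_lift_fusion[OF clinear_embed])
      (auto intro!: multilinear simp: mtensor_mult simp flip: mtensor_embed embed_T)
  have R: "tensor_lift (\<lambda>p q. mtensor (embed p) (\<Delta> q)) t * mtensor 1 (mtensor 1 (embed b))
      = embed (tensor_lift (\<lambda>p q. p \<otimes> T1 q b) t)" for t
    by (subst clinear_tensor_lift_fusion[OF l2 b2], subst clinear_tensor_lift_fusion[OF clinear_embed])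
      (auto intro!: multilinear simp: mtensor_mult simp flip: mtensor_embed embed_T)
  have "inj (embed :: ('a, ('a, 'a) tensor) tensor \<Rightarrow> _)"
    by (rule inj_embed_tensor[OF nondegenerate_left nondegenerate_left_tensor[OF nondegenerate_left nondegenerate_left]])
      auto
  moreover have "embed (tensor_assoc (tensor_lift (\<lambda>p q. T2 a p \<otimes> q) (T1 c b)))
    = embed (tensor_lift (\<lambda>p q. p \<otimes> T1 q b) (T2 a c))"
    using coassociative[of a c b]
    by (simp add: L R multiplier_map_embed algebra_iso_tensor_assoc flip: T1_def T2_def)
  ultimately show ?thesis by (rule injD)
qed

text \<open>Coassociativity for covered Sweedler sums: \<open>F(a c\<^sub>1, c\<^sub>2, c\<^sub>3 b)\<close> may be formed by
  splitting either leg of the coproduct first.\<close>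

lemma coassociative_sum:
  assumes F1: "\<And>s q. clinear (\<lambda>r. F r s q)" and F2: "\<And>r q. clinear (\<lambda>s. F r s q)"
    and F3: "\<And>r s. clinear (\<lambda>q. F r s q)"
  shows "tensor_lift (\<lambda>p q. tensor_lift (\<lambda>r s. F r s q) (T2 a p)) (T1 c b)
    = tensor_lift (\<lambda>r t. tensor_lift (F r) (T1 t b)) (T2 a c)"
proof -
  have b: "cbilinear (F r)" "cbilinear (\<lambda>r s. F r s q)" for r q
    by (intro multilinear assms)+
  have B: "cbilinear (\<lambda>r u. tensor_lift (F r) u)"
    by (intro multilinear assms b clinear_tensor_lift)
  let ?G = "tensor_lift (\<lambda>r u. tensor_lift (F r) u)"
  have a: "?G (tensor_assoc (t \<otimes> q)) = tensor_lift (\<lambda>r s. F r s q) t" for t q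
    by (rule tensor_ext[where f = "\<lambda>t. ?G (tensor_assoc (t \<otimes> q))"])
      (auto intro!: multilinear clinear_compose[OF clinear_tensor_assoc] B b
        simp: tensor_assoc_tensor tensor_lift_tensor B b)
  have "?G (tensor_assoc (tensor_lift (\<lambda>p q. T2 a p \<otimes> q) (T1 c b)))
      = tensor_lift (\<lambda>p q. ?G (tensor_assoc (T2 a p \<otimes> q))) (T1 c b)"
    by (rule clinear_tensor_lift_fusion[where h = "\<lambda>t. ?G (tensor_assoc t)"])
      (auto intro!: multilinear clinear_compose[OF clinear_tensor_assoc] clinear_tensor_assoc B)
  moreover have "?G (tensor_lift (\<lambda>p q. p \<otimes> T1 q b) (T2 a c))
      = tensor_lift (\<lambda>p q. ?G (p \<otimes> T1 q b)) (T2 a c)"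
    by (rule clinear_tensor_lift_fusion) (intro multilinear B clinear_tensor_lift)+
  ultimately show ?thesis
    by (simp add: a coassociative_tensor tensor_lift_tensor B)
qed

text \<open>Exchanging covers: \<open>(w \<otimes> 1)\<Delta>(e)(1 \<otimes> f)\<close> is bracketed in two ways.\<close>

lemma T2_T1_sum:
  assumes F: "cbilinear F"
  shows "tensor_lift (\<lambda>a c. F (w * a) c) (T1 e f) = tensor_lift (\<lambda>p q. F p (q * f)) (T2 w e)"
proof -
  have "embed (lmul (mtensor (embed w) 1) (T1 e f)) = embed (rmul (mtensor 1 (embed f)) (T2 w e))"
    by (simp add: embed_T mult.assoc flip: mult_embed embed_mult_multiplier)
  then have "lmul (mtensor (embed w) 1) (T1 e f) = rmul (mtensor 1 (embed f)) (T2 w e)"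
    by (rule injD[OF inj_embed2])
  then show ?thesis
    using tensor_lift_lmul_rmul(1)[OF F, of "embed w" 1 "T1 e f"]
      tensor_lift_lmul_rmul(2)[OF F, of 1 "embed f" "T2 w e"] by simp
qed

text \<open>With \<open>\<Delta>(f)(1 \<otimes> d) = g \<otimes> h\<close> one has
  \<open>\<Delta>(q f)(1 \<otimes> d) = \<Delta>(q)(g \<otimes> h) = \<Delta>(q)(1 \<otimes> h) (g \<otimes> 1)\<close>.\<close>

lemma T1_mult: "T1 (q * f) d = tensor_lift (\<lambda>g h. tensor_lift (\<lambda>s v. (s * g) \<otimes> v) (T1 q h)) (T1 f d)"
proof -
  have c: "mtensor 1 (embed h) * mtensor (embed g) 1 = embed (g \<otimes> h)" for g h
    by (simp add: mtensor_mult flip: mtensor_embed)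
  have *: "lmul (\<Delta> q) (g \<otimes> h) = tensor_lift (\<lambda>s v. (s * g) \<otimes> v) (T1 q h)" for g h
  proof -
    have "embed (lmul (\<Delta> q) (g \<otimes> h)) = embed (rmul (mtensor (embed g) 1) (T1 q h))"
      by (simp add: embed_T mult.assoc c flip: mult_embed embed_mult_multiplier)
    then have "lmul (\<Delta> q) (g \<otimes> h) = rmul (mtensor (embed g) 1) (T1 q h)"
      by (rule injD[OF inj_embed2])
    then show ?thesis
      using tensor_lift_lmul_rmul(2)[OF cbilinear_tensor, of "embed g" 1 "T1 q h"]
      by (simp add: tensor_lift_tensor_id)
  qed
  have "embed (T1 (q * f) d) = embed (lmul (\<Delta> q) (T1 f d))"
    by (simp add: embed_T coproduct_mult mult.assoc flip: mult_embed)
  then have "T1 (q * f) d = lmul (\<Delta> q) (T1 f d)" by (rule injD[OF inj_embed2])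
  also have "\<dots> = lmul (\<Delta> q) (tensor_lift (\<otimes>) (T1 f d))" by (simp only: tensor_lift_tensor_id)
  also have "\<dots> = tensor_lift (\<lambda>g h. lmul (\<Delta> q) (g \<otimes> h)) (T1 f d)"
    by (rule clinear_tensor_lift_fusion[OF clinear_lmul cbilinear_tensor])
  finally show ?thesis by (simp add: *)
qed

section \<open>The counit and the antipode\<close>

text \<open>The counit is given through its left leg only. The other leg follows: after right
  multiplication by \<open>b\<close> and the replacement of \<open>c \<otimes> b\<close> by \<open>c\<^sub>1 \<otimes> c\<^sub>2 b\<close> the claim becomes
  \<open>a c\<^sub>1 \<epsilon>(c\<^sub>2) c\<^sub>3 b = a c\<^sub>1 c\<^sub>2 b\<close>, in which \<open>\<epsilon>\<close> also sits on the left leg of \<open>\<Delta>(c\<^sub>2)\<close>.\<close>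

lemma counit_right:
  assumes "is_counit \<Delta> \<epsilon>"
  shows "tensor_lift (\<lambda>r s. \<epsilon> s *\<^sub>C r) (T2 a c) = a * c"
proof -
  have e [multilinear]: "clinear f \<Longrightarrow> clinear (\<lambda>x. \<epsilon> (f x))" for f :: "'x::complex_vector \<Rightarrow> 'a"
    using assms by (auto simp: is_counit_def intro: clinear_compose)
  have e1: "tensor_lift (\<lambda>s q. \<epsilon> s *\<^sub>C q) (T1 t b) = t * b" for t b
    using assms by (simp add: is_counit_def slice_left_def T1_def)
  have "tensor_lift (\<lambda>r s. \<epsilon> s *\<^sub>C r) (T2 a c) * b = (a * c) * b" for b
  proof (rule eq_on_T1[where F = "\<lambda>c b. tensor_lift (\<lambda>r s. \<epsilon> s *\<^sub>C r) (T2 a c) * b"])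
    show "cbilinear (\<lambda>c b. tensor_lift (\<lambda>r s. \<epsilon> s *\<^sub>C r) (T2 a c) * b)" "cbilinear (\<lambda>c b. a * c * b)"
      by (intro multilinear)+
    fix c b
    have "tensor_lift (\<lambda>p q. tensor_lift (\<lambda>r s. \<epsilon> s *\<^sub>C r) (T2 a p) * q) (T1 c b)
      = tensor_lift (\<lambda>p q. tensor_lift (\<lambda>r s. (\<epsilon> s *\<^sub>C r) * q) (T2 a p)) (T1 c b)"
      by (subst clinear_tensor_lift_fusion[where h = "\<lambda>x. x * _"]) (intro multilinear refl)+
    also have "\<dots> = tensor_lift (\<lambda>r t. tensor_lift (\<lambda>s q. (\<epsilon> s *\<^sub>C r) * q) (T1 t b)) (T2 a c)"
      by (rule coassociative_sum) (intro multilinear)+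
    also have "\<dots> = tensor_lift (\<lambda>r t. r * tensor_lift (\<lambda>s q. \<epsilon> s *\<^sub>C q) (T1 t b)) (T2 a c)"
    proof -
      have "tensor_lift (\<lambda>s q. (\<epsilon> s *\<^sub>C r) * q) (T1 t b) = r * tensor_lift (\<lambda>s q. \<epsilon> s *\<^sub>C q) (T1 t b)" for r t
        by (subst clinear_tensor_lift_fusion[OF clinear_mult_left])
          (intro multilinear, intro arg_cong[where f = "\<lambda>F. tensor_lift F (T1 t b)"] ext,
            simp only: mult_scaleC_left mult_scaleC_right)
      then show ?thesis by simp
    qed
    also have "\<dots> = tensor_lift (\<lambda>p q. a * p * q) (T1 c b)"
      by (simp add: e1 T2_T1_sum[where F = "(*)"] cbilinearI' clinear_mult_left clinear_mult_right)
    finally show "tensor_lift (\<lambda>p q. tensor_lift (\<lambda>r s. \<epsilon> s *\<^sub>C r) (T2 a p) * q) (T1 c b)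
      = tensor_lift (\<lambda>p q. a * p * q) (T1 c b)" .
  qed
  then have "\<forall>b. (tensor_lift (\<lambda>r s. \<epsilon> s *\<^sub>C r) (T2 a c) - a * c) * b = 0"
    by (simp add: left_diff_distrib)
  then show ?thesis using nondegenerate_left by fastforce
qed

text \<open>The pentagon equation for the first canonical map; both sides are
  \<open>e\<^sub>1 \<otimes> e\<^sub>2 f\<^sub>1 \<otimes> e\<^sub>3 f\<^sub>2 d\<close>. It expresses coassociativity together with multiplicativity of
  \<open>\<Delta>\<close> without any cover on the first leg. That leg has to stay uncovered for a later
  application of \<open>S(e\<^sub>1) e\<^sub>2\<close>: a factor \<open>w\<close> in front of \<open>e\<^sub>1\<close> would end up between \<open>S(e\<^sub>1)\<close>
  and \<open>e\<^sub>2\<close>. In the proof such a \<open>w\<close> is introduced in order to use coassociativity, and then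
  cancelled.\<close>

lemma pentagon:
  "tensor_lift (\<lambda>a c. a \<otimes> T1 c d) (T1 e f)
    = tensor_lift (\<lambda>g h. tensor_lift (\<lambda>u v. tensor_lift (\<lambda>a s. a \<otimes> (s \<otimes> v)) (T1 u g)) (T1 e h)) (T1 f d)"
    (is "?X = ?Y")
proof -
  have "?X - ?Y = 0"
  proof (rule separating_family_tensor_left[where f = "(*)"])
    show "clinear ((*) w)" for w :: 'a by (rule clinear_mult_left)
    show "p = 0" if "\<And>w. w * p = 0" for p :: 'a using nondegenerate_right that by blast
    fix w
    let ?L = "tensor_lift (\<lambda>p q. (w * p) \<otimes> q) :: ('a, ('a, 'a) tensor) tensor \<Rightarrow> _"
    have b: "cbilinear (\<lambda>p q. (w * p) \<otimes> (q :: ('a, 'a) tensor))" by (intro multilinear)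
    have L: "clinear ?L" "?L (p \<otimes> q) = (w * p) \<otimes> q" for p q
      by (simp_all add: clinear_tensor_lift tensor_lift_tensor b)
    have "?L ?X = tensor_lift (\<lambda>a c. (w * a) \<otimes> T1 c d) (T1 e f)"
      by (subst clinear_tensor_lift_fusion[OF L(1)]) (intro multilinear | simp add: L)+
    also have "\<dots> = tensor_lift (\<lambda>p q. p \<otimes> T1 (q * f) d) (T2 w e)"
      by (rule T2_T1_sum[where F = "\<lambda>a c. a \<otimes> T1 c d"]) (intro multilinear)
    also have "\<dots> = tensor_lift (\<lambda>p q. tensor_lift (\<lambda>g h.
        tensor_lift (\<lambda>s v. p \<otimes> ((s * g) \<otimes> v)) (T1 q h)) (T1 f d)) (T2 w e)"
    proof -
      have "p \<otimes> T1 (q * f) d = tensor_lift (\<lambda>g h.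
        tensor_lift (\<lambda>s v. p \<otimes> ((s * g) \<otimes> v)) (T1 q h)) (T1 f d)" for p q :: 'a
        unfolding T1_mult
        by (subst clinear_tensor_lift_fusion[where h = "\<lambda>x. p \<otimes> x"], intro multilinear, intro multilinear,
          subst clinear_tensor_lift_fusion[where h = "\<lambda>x. p \<otimes> x"], intro multilinear, intro multilinear, rule refl)
      then show ?thesis by simp
    qed
    also have "\<dots> = tensor_lift (\<lambda>g h. tensor_lift (\<lambda>p q.
        tensor_lift (\<lambda>s v. p \<otimes> ((s * g) \<otimes> v)) (T1 q h)) (T2 w e)) (T1 f d)"
      by (rule tensor_lift_swap) (intro multilinear)+
    also have "\<dots> = tensor_lift (\<lambda>g h. tensor_lift (\<lambda>u v.
        tensor_lift (\<lambda>p s. p \<otimes> ((s * g) \<otimes> v)) (T2 w u)) (T1 e h)) (T1 f d)"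
      by (subst coassociative_sum) (intro multilinear refl)+
    also have "\<dots> = tensor_lift (\<lambda>g h. tensor_lift (\<lambda>u v.
        tensor_lift (\<lambda>a s. (w * a) \<otimes> (s \<otimes> v)) (T1 u g)) (T1 e h)) (T1 f d)"
      by (subst T2_T1_sum[where F = "\<lambda>a s. a \<otimes> (s \<otimes> _)"]) (intro multilinear refl)+
    also have "\<dots> = ?L ?Y"
    proof -
      have L1: "?L (tensor_lift (\<lambda>u v. tensor_lift (\<lambda>a s. a \<otimes> (s \<otimes> v)) (T1 u g)) (T1 e h))
         = tensor_lift (\<lambda>u v. ?L (tensor_lift (\<lambda>a s. a \<otimes> (s \<otimes> v)) (T1 u g))) (T1 e h)" for g h
        by (rule clinear_tensor_lift_fusion[OF L(1)]) (intro multilinear)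
      have L2: "?L (tensor_lift (\<lambda>a s. a \<otimes> (s \<otimes> v)) (T1 u g))
         = tensor_lift (\<lambda>a s. ?L (a \<otimes> (s \<otimes> v))) (T1 u g)" for u v g
        by (rule clinear_tensor_lift_fusion[OF L(1)]) (intro multilinear)
      have "?L ?Y = tensor_lift (\<lambda>g h. ?L (tensor_lift (\<lambda>u v.
          tensor_lift (\<lambda>a s. a \<otimes> (s \<otimes> v)) (T1 u g)) (T1 e h))) (T1 f d)"
        by (rule clinear_tensor_lift_fusion[OF L(1)]) (intro multilinear)
      then show ?thesis by (simp only: L1 L2 L(2))
    qed
    finally show "?L (?X - ?Y) = 0" by (simp add: clinear_diff[OF L(1)])
  qed
  then show ?thesis by simp
qed

text \<open>The formula \<open>(1 \<otimes> z a\<^sub>1) \<Delta>(S(a\<^sub>2)) = S(a) \<otimes> z\<close>, a covered version of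
  \<open>\<Delta>(S(a)) = S(a\<^sub>2) \<otimes> S(a\<^sub>1)\<close>. It is tested against right multiplication by
  \<open>\<Delta>(c)(1 \<otimes> d)\<close>, with \<open>e\<^sub>1 \<otimes> e\<^sub>2 f\<close> in place of \<open>a \<otimes> c\<close>; then both sides reduce to
  \<open>(1 \<otimes> z e) \<Delta>(f) (1 \<otimes> d)\<close>.\<close>

lemma antipode_coproduct:
  assumes e: "is_counit \<Delta> \<epsilon>" and S: "is_antipode \<Delta> \<epsilon> S"
  shows "tensor_lift (\<lambda>p q. T4 p (S q)) (T2 z a) = S a \<otimes> z"
proof -
  have lS [multilinear]: "clinear f \<Longrightarrow> clinear (\<lambda>x. S (f x))" for f :: "'x::complex_vector \<Rightarrow> 'a"
    using S by (auto simp: is_antipode_def intro: clinear_compose)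
  have le [multilinear]: "clinear f \<Longrightarrow> clinear (\<lambda>x. \<epsilon> (f x))" for f :: "'x::complex_vector \<Rightarrow> 'a"
    using e by (auto simp: is_counit_def intro: clinear_compose)
  have S1: "tensor_lift (\<lambda>p q. S p * q) (T1 a b) = \<epsilon> a *\<^sub>C b" for a b
    using S by (simp add: is_antipode_def T1_def)
  have e1: "tensor_lift (\<lambda>s q. \<epsilon> s *\<^sub>C q) (T1 t b) = t * b" for t b
    using e by (simp add: is_counit_def slice_left_def T1_def)
  \<comment> \<open>Left multiplication by \<open>1 \<otimes> p\<close>.\<close>
  let ?l = "\<lambda>p. lmul (mtensor 1 (embed p))"
  have l_tensor: "?l p (x \<otimes> y) = x \<otimes> (p * y)" for p x y
    by (simp add: lmul_mtensor tensor_map_tensor clinear_lmul)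
  have ll [multilinear]: "clinear f \<Longrightarrow> clinear (\<lambda>x. ?l (f x) t)" for f :: "'x::complex_vector \<Rightarrow> 'a" and t
    by (simp add: clinear_iff clinear_add[OF clinear_embed] clinear_scaleC[OF clinear_embed]
        cbilinearD[OF cbilinear_mtensor])
  have T4: "T4 p y * T1 c d = ?l p (T1 (y * c) d)" for p y c d
    by (rule injD[OF inj_embed2])
      (simp add: embed_T embed_mult coproduct_mult mult.assoc flip: mult_embed)
  have main: "tensor_lift (\<lambda>p q. ?l p (T1 (S q * c) d)) (T2 z a) = (S a \<otimes> z) * T1 c d" for a c d
  proof (rule eq_on_T1[where F = "\<lambda>a c. tensor_lift (\<lambda>p q. ?l p (T1 (S q * c) d)) (T2 z a)"])
    show "cbilinear (\<lambda>a c. tensor_lift (\<lambda>p q. ?l p (T1 (S q * c) d)) (T2 z a))"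
      by (intro multilinear)
    show "cbilinear (\<lambda>a c. (S a \<otimes> z) * T1 c d)"
      by (intro multilinear)
    fix e f
    have SS: "tensor_lift (\<lambda>q c. ?l p (T1 (S q * c) d)) (T1 t f) = ?l (\<epsilon> t *\<^sub>C p) (T1 f d)" for p t
    proof -
      have "tensor_lift (\<lambda>q c. ?l p (T1 (S q * c) d)) (T1 t f)
        = ?l p (T1 (tensor_lift (\<lambda>p q. S p * q) (T1 t f)) d)"
        by (rule clinear_tensor_lift_fusion[where h = "\<lambda>x. ?l p (T1 x d)", symmetric]) (intro multilinear)+
      also have "\<dots> = ?l (\<epsilon> t *\<^sub>C p) (T1 f d)"
        by (simp add: S1 cbilinearD[OF cbilinear_T(1)] clinear_scaleC[OF clinear_lmul]
            clinear_scaleC[OF clinear_embed] cbilinearD[OF cbilinear_mtensor])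
      finally show ?thesis .
    qed
    have "tensor_lift (\<lambda>a c. tensor_lift (\<lambda>p q. ?l p (T1 (S q * c) d)) (T2 z a)) (T1 e f)
      = tensor_lift (\<lambda>p t. tensor_lift (\<lambda>q c. ?l p (T1 (S q * c) d)) (T1 t f)) (T2 z e)"
      by (rule coassociative_sum) (intro multilinear)+
    also have "\<dots> = tensor_lift (\<lambda>p t. ?l (\<epsilon> t *\<^sub>C p) (T1 f d)) (T2 z e)"
      by (simp only: SS)
    also have "\<dots> = ?l (tensor_lift (\<lambda>p t. \<epsilon> t *\<^sub>C p) (T2 z e)) (T1 f d)"
      by (rule clinear_tensor_lift_fusion[where h = "\<lambda>x. ?l x (T1 f d)", symmetric]) (intro multilinear)+
    also have "\<dots> = ?l (z * e) (tensor_lift (\<otimes>) (T1 f d))"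
      by (simp only: counit_right[OF e] tensor_lift_tensor_id)
    also have "\<dots> = tensor_lift (\<lambda>g h. g \<otimes> (z * e * h)) (T1 f d)"
      by (subst clinear_tensor_lift_fusion[OF clinear_lmul cbilinear_tensor]) (simp add: l_tensor)
    finally have L: "tensor_lift (\<lambda>a c. tensor_lift (\<lambda>p q. ?l p (T1 (S q * c) d)) (T2 z a)) (T1 e f)
      = tensor_lift (\<lambda>g h. g \<otimes> (z * e * h)) (T1 f d)" .
    \<comment> \<open>\<open>?H\<close> is \<open>a \<otimes> s \<otimes> v \<mapsto> S(a) s \<otimes> z v\<close>; applied to the pentagon it makes
      \<open>S(e\<^sub>1) e\<^sub>2\<close> appear.\<close>
    let ?H = "tensor_lift (\<lambda>a t. (S a \<otimes> z) * t)"
    have b: "cbilinear (\<lambda>a t. (S a \<otimes> z) * t)" by (intro multilinear)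
    note H = clinear_tensor_lift[OF b] tensor_lift_tensor[OF b]
    have S2: "tensor_lift (\<lambda>a s. ?H (a \<otimes> (s \<otimes> v))) (T1 u g) = g \<otimes> (z * (\<epsilon> u *\<^sub>C v))" for u v g
    proof -
      have "tensor_lift (\<lambda>a s. ?H (a \<otimes> (s \<otimes> v))) (T1 u g) = tensor_lift (\<lambda>a s. (S a * s) \<otimes> (z * v)) (T1 u g)"
        by (simp add: H(2) tensor_mult)
      also have "\<dots> = tensor_lift (\<lambda>a s. S a * s) (T1 u g) \<otimes> (z * v)"
        by (rule clinear_tensor_lift_fusion[where h = "\<lambda>x. x \<otimes> (z * v)", symmetric]) (intro multilinear)+
      finally show ?thesis by (simp add: S1 tensor_simps mult_scaleC_right)
    qed
    have S3: "tensor_lift (\<lambda>u v. g \<otimes> (z * (\<epsilon> u *\<^sub>C v))) (T1 e h) = g \<otimes> (z * e * h)" for g h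
    proof -
      have "tensor_lift (\<lambda>u v. g \<otimes> (z * (\<epsilon> u *\<^sub>C v))) (T1 e h)
        = g \<otimes> (z * tensor_lift (\<lambda>u v. \<epsilon> u *\<^sub>C v) (T1 e h))"
        by (rule clinear_tensor_lift_fusion[where h = "\<lambda>x. g \<otimes> (z * x)", symmetric]) (intro multilinear)+
      then show ?thesis by (simp add: e1 mult.assoc)
    qed
    have "tensor_lift (\<lambda>a c. (S a \<otimes> z) * T1 c d) (T1 e f)
      = ?H (tensor_lift (\<lambda>a c. a \<otimes> T1 c d) (T1 e f))"
      by (subst clinear_tensor_lift_fusion[OF H(1)]) (intro multilinear | simp add: H(2))+
    also have "\<dots> = tensor_lift (\<lambda>g h. tensor_lift (\<lambda>u v.
        tensor_lift (\<lambda>a s. ?H (a \<otimes> (s \<otimes> v))) (T1 u g)) (T1 e h)) (T1 f d)"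
      unfolding pentagon
      by (subst clinear_tensor_lift_fusion[OF H(1)], intro multilinear,
          subst clinear_tensor_lift_fusion[OF H(1)], intro multilinear,
          subst clinear_tensor_lift_fusion[OF H(1)], intro multilinear, rule refl)
    also have "\<dots> = tensor_lift (\<lambda>g h. g \<otimes> (z * e * h)) (T1 f d)"
      by (subst S2, subst S3, rule refl)
    finally show "tensor_lift (\<lambda>a c. tensor_lift (\<lambda>p q. ?l p (T1 (S q * c) d)) (T2 z a)) (T1 e f)
      = tensor_lift (\<lambda>a c. (S a \<otimes> z) * T1 c d) (T1 e f)"
      by (simp add: L)
  qed
  let ?t = "tensor_lift (\<lambda>p q. T4 p (S q)) (T2 z a)"
  have t: "?t * T1 c d = (S a \<otimes> z) * T1 c d" for c d
  proof -
    have "?t * T1 c d = tensor_lift (\<lambda>p q. T4 p (S q) * T1 c d) (T2 z a)"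
      by (rule clinear_tensor_lift_fusion[where h = "\<lambda>x. x * T1 c d"]) (intro multilinear)+
    then show ?thesis by (simp add: T4 main)
  qed
  have tu: "?t * u = (S a \<otimes> z) * u" for u
    by (rule eq_on_canonical1[OF clinear_mult_left clinear_mult_left]) (simp add: t flip: T1_def)
  have "?t - S a \<otimes> z = 0"
    by (rule nondegenerate_left_tensor[OF nondegenerate_left nondegenerate_left])
      (simp_all add: left_diff_distrib tu)
  then show ?thesis by simp
qed

section \<open>Strong right invariance and the Fourier transform\<close>

text \<open>The two slices are compatible as parts of one multiplier because slicing the first leg
  commutes with multiplication on the second, so the slice exists in \<open>M(A)\<close>.\<close>

lemma mslice_left:
  assumes \<omega>: "clinear \<omega>"
  shows "lmul (mslice_left \<omega> (\<Delta> x)) a = slice_left \<omega> (T1 x a)"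
    and "rmul (mslice_left \<omega> (\<Delta> x)) a = slice_left \<omega> (T4 a x)"
proof -
  let ?L = "\<lambda>a. slice_left \<omega> (T1 x a)" and ?R = "\<lambda>a. slice_left \<omega> (T4 a x)"
  note covers = injD[OF inj_embed2, of "T1 x (a * b)" "rmul (mtensor 1 (embed b)) (T1 x a)" for a b]
    injD[OF inj_embed2, of "T4 (a * b) x" "lmul (mtensor 1 (embed a)) (T4 b x)" for a b]
    injD[OF inj_embed2, of "lmul (mtensor 1 (embed a)) (T1 x b)" "rmul (mtensor 1 (embed b)) (T4 a x)" for a b]
  have "clinear ?L" "clinear ?R"
    by (intro clinear_compose[OF clinear_slice_left[OF \<omega>]] multilinear)+
  moreover have "?L (a * b) = ?L a * b" for a b
    using covers(1)[of a b] slice_left_lmul(2)[OF \<omega>, of "embed b" "T1 x a"]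
    by (simp add: embed_T mult.assoc mtensor_mult embed_mult flip: embed_mult_multiplier mult_embed)
  moreover have "?R (a * b) = a * ?R b" for a b
    using covers(2)[of a b] slice_left_lmul(1)[OF \<omega>, of "embed a" "T4 b x"]
    by (simp add: embed_T mtensor_mult embed_mult flip: embed_mult_multiplier mult_embed mult.assoc)
  moreover have "a * ?L b = ?R a * b" for a b
    using covers(3)[of a b] slice_left_lmul(1)[OF \<omega>, of "embed a" "T1 x b"]
      slice_left_lmul(2)[OF \<omega>, of "embed b" "T4 a x"]
    by (simp add: embed_T mult.assoc flip: embed_mult_multiplier mult_embed)
  ultimately have m: "is_multiplier ?L ?R" by (simp add: is_multiplier_def)
  have "\<exists>!n. \<forall>a. lmul n a = ?L a \<and> rmul n a = ?R a"
  proof (rule ex1I[of _ "Abs_multiplier (?L, ?R)"])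
    show "\<forall>a. lmul (Abs_multiplier (?L, ?R)) a = ?L a \<and> rmul (Abs_multiplier (?L, ?R)) a = ?R a"
      using m by (simp add: lmul.rep_eq rmul.rep_eq Abs_multiplier_inverse)
    then show "n = Abs_multiplier (?L, ?R)" if "\<forall>a. lmul n a = ?L a \<and> rmul n a = ?R a" for n
      using that by (intro multiplier_eqI) metis+
  qed
  from theI'[OF this] show "lmul (mslice_left \<omega> (\<Delta> x)) a = ?L a"
    "rmul (mslice_left \<omega> (\<Delta> x)) a = ?R a"
    by (simp_all add: mslice_left_def flip: T1_def T4_def)
qed

text \<open>By \<open>w (m z) = (w m) z\<close> and non-degeneracy, a multiplier is determined by its right
  action alone.\<close>

lemma multiplier_eqI_right:
  assumes "\<And>a::'a. rmul m a = rmul n a"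
  shows "m = n"
proof (rule multiplier_eqI)
  fix z
  have "w * (lmul m z - lmul n z) = 0" for w
    by (simp add: right_diff_distrib mult_lmul assms)
  then show "lmul m z = lmul n z" using nondegenerate_right by fastforce
qed (rule assms)

text \<open>Covered by \<open>z\<close>, the computation is
  \<open>z a\<^sub>1 \<psi>(S(a\<^sub>2) x) = (\<psi> \<otimes> \<iota>)((1 \<otimes> z a\<^sub>1) \<Delta>(S(a\<^sub>2)) \<Delta>(x)) = (\<psi> \<otimes> \<iota>)((S(a) \<otimes> z) \<Delta>(x))\<close>,
  by invariance and by the formula for \<open>\<Delta> S\<close>. In particular the slice of \<open>\<Delta>(a)\<close> by
  \<open>\<F>(x)\<close> lies in \<open>A\<close>, so that the product with \<open>\<F>(x)\<close> in the dual can be evaluated.\<close>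

lemma strong_right_invariance:
  assumes "is_counit \<Delta> \<epsilon>" and S: "is_antipode \<Delta> \<epsilon> S" and \<psi>: "right_integral \<Delta> \<psi>"
  shows "mslice_right (\<lambda>q. \<psi> (S q * x)) (\<Delta> a) = embed (slice_left \<psi> (T2 (S a) x))"
proof (rule multiplier_eqI_right)
  fix z
  have p: "clinear \<psi>" and inv: "mslice_left \<psi> (\<Delta> y) = \<psi> y *\<^sub>C 1" for y
    using \<psi> by (simp_all add: right_integral_def)
  have lp [multilinear]: "clinear f \<Longrightarrow> clinear (\<lambda>x. \<psi> (f x))" for f :: "'x::complex_vector \<Rightarrow> 'a"
    by (rule clinear_compose[OF p])
  have lS [multilinear]: "clinear f \<Longrightarrow> clinear (\<lambda>x. S (f x))" for f :: "'x::complex_vector \<Rightarrow> 'a"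
    using S by (auto simp: is_antipode_def intro: clinear_compose)
  have F: "clinear (\<lambda>q. \<psi> (S q * x))" by (intro multilinear)
  have I: "\<psi> y *\<^sub>C p = slice_left \<psi> (T4 p y)" for y p
    using mslice_left(2)[OF p, of y p] by (simp add: inv)
  have T4: "T4 p (y * x) = rmul (\<Delta> x) (T4 p y)" for p y
    by (rule injD[OF inj_embed2]) (simp add: embed_T coproduct_mult mult.assoc flip: embed_mult_multiplier)
  have "rmul (mslice_right (\<lambda>q. \<psi> (S q * x)) (\<Delta> a)) z
      = tensor_lift (\<lambda>p q. \<psi> (S q * x) *\<^sub>C p) (T2 z a)"
    by (simp add: mslice_right(2)[OF F] slice_right_def T2_def)
  also have "\<dots> = tensor_lift (\<lambda>p q. slice_left \<psi> (rmul (\<Delta> x) (T4 p (S q)))) (T2 z a)"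
    by (simp add: I T4)
  also have "\<dots> = slice_left \<psi> (rmul (\<Delta> x) (tensor_lift (\<lambda>p q. T4 p (S q)) (T2 z a)))"
    by (rule clinear_tensor_lift_fusion[where h = "\<lambda>t. slice_left \<psi> (rmul (\<Delta> x) t)", symmetric])
      (intro multilinear clinear_compose[OF clinear_slice_left[OF p]])+
  also have "\<dots> = slice_left \<psi> (rmul (\<Delta> x) (S a \<otimes> z))"
    by (simp only: antipode_coproduct[OF assms(1,2)])
  also have "rmul (\<Delta> x) (S a \<otimes> z) = lmul (mtensor 1 (embed z)) (T2 (S a) x)"
  proof (rule injD[OF inj_embed2])
    have "embed (S a \<otimes> z) = mtensor 1 (embed z) * mtensor (embed (S a)) 1"
      by (simp add: mtensor_mult mtensor_embed)
    then show "embed (rmul (\<Delta> x) (S a \<otimes> z)) = embed (lmul (mtensor 1 (embed z)) (T2 (S a) x))"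
      by (simp add: embed_T mult.assoc flip: embed_mult_multiplier mult_embed)
  qed
  also have "slice_left \<psi> \<dots> = rmul (embed (slice_left \<psi> (T2 (S a) x))) z"
    by (simp add: slice_left_lmul(1)[OF p])
  finally show "rmul (mslice_right (\<lambda>q. \<psi> (S q * x)) (\<Delta> a)) z
    = rmul (embed (slice_left \<psi> (T2 (S a) x))) z" .
qed

text \<open>For \<open>b = \<phi>(\<cdot> c)\<close> both sides at \<open>a\<close> are \<open>(\<psi> \<otimes> \<phi>)((S(a) \<otimes> 1) \<Delta>(x) (1 \<otimes> c))\<close>: slicing with
  \<open>\<phi>\<close> first gives \<open>\<psi>(S(a) (b \<triangleright> x))\<close>, slicing with \<open>\<psi>\<close> first gives
  the value of \<open>b\<close> at \<open>(\<psi> \<otimes> \<iota>)((S(a) \<otimes> 1) \<Delta>(x))\<close>, which strong invariance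
  identifies with \<open>(\<iota> \<otimes> \<F>(x)) \<Delta>(a)\<close>.\<close>

lemma fourier_dual_act:
  assumes "is_counit \<Delta> \<epsilon>" and S: "is_antipode \<Delta> \<epsilon> S"
    and \<psi>: "right_integral \<Delta> \<psi>" and \<phi>: "clinear \<phi>" and b: "b \<in> dual \<phi>"
  shows "fourier \<psi> S (dual_act \<Delta> b x) = dual_mult \<Delta> b (fourier \<psi> S x)"
proof
  fix a
  obtain c where c: "b = (\<lambda>a. \<phi> (a * c))" using b by (auto simp: dual_def)
  have p: "clinear \<psi>" using \<psi> by (simp add: right_integral_def)
  have "embed (lmul (mtensor (embed (S a)) 1) (T1 x c)) = embed (rmul (mtensor 1 (embed c)) (T2 (S a) x))"
    by (simp add: embed_T mult.assoc flip: mult_embed embed_mult_multiplier)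
  then have T: "lmul (mtensor (embed (S a)) 1) (T1 x c) = rmul (mtensor 1 (embed c)) (T2 (S a) x)"
    by (rule injD[OF inj_embed2])
  have "fourier \<psi> S (dual_act \<Delta> b x) a = \<psi> (S a * slice_right \<phi> (T1 x c))"
    by (simp add: fourier_def c dual_act_eq[OF \<phi>] T1_def)
  also have "\<dots> = \<psi> (slice_right \<phi> (lmul (mtensor (embed (S a)) 1) (T1 x c)))"
    by (simp add: slice_right_lmul(1)[OF \<phi>])
  also have "\<dots> = \<phi> (slice_left \<psi> (rmul (mtensor 1 (embed c)) (T2 (S a) x)))"
    by (simp add: slice_swap[OF p \<phi>] T)
  also have "\<dots> = b (slice_left \<psi> (T2 (S a) x))"
    by (simp add: slice_left_lmul(2)[OF p] c)
  also have "\<dots> = dual_mult \<Delta> b (fourier \<psi> S x) a"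
    by (simp add: dual_mult_def tensor_pairing_def fourier_def unembed_embed[OF inj_embed]
        strong_right_invariance[OF assms(1,2,3)])
  finally show "fourier \<psi> S (dual_act \<Delta> b x) a = dual_mult \<Delta> b (fourier \<psi> S x) a" .
qed

end

theorem proposition3p20:
  fixes \<Delta> :: "'a::complex_algebra \<Rightarrow> ('a, 'a) tensor multiplier"
    and \<epsilon> \<phi> \<psi> :: "'a \<Rightarrow> complex" and S :: "'a \<Rightarrow> 'a"
  assumes "algebraic_quantum_group \<Delta>"
    and "is_counit \<Delta> \<epsilon>" and "is_antipode \<Delta> \<epsilon> S"
    and "left_integral \<Delta> \<phi>" and "right_integral \<Delta> \<psi>"
  shows "(\<forall>a x. fourier \<psi> S (a * x) = act_on_dual (fourier \<psi> S x) (inv S a)) \<and>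
    (\<forall>b\<in>dual \<phi>. \<forall>x. fourier \<psi> S (dual_act \<Delta> b x) = dual_mult \<Delta> b (fourier \<psi> S x))"
proof -
  interpret algebraic_quantum_group \<Delta> by (rule assms(1))
  have "S (inv S a * a') = S a' * a" for a a'
    using assms(3) by (simp add: is_antipode_def bij_is_surj surj_f_inv_f)
  moreover have "clinear \<phi>" using assms(4) by (simp add: left_integral_def)
  ultimately show ?thesis
    using fourier_dual_act[OF assms(2,3,5)]
    by (auto simp: fourier_def act_on_dual_def mult.assoc)
qed

end
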